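(* Let $m$ be a positive integer and $k>3$ an integer, and let $D>0$, $r\in\mathbb{Z}$ with $D\equiv -r^2\pmod{4m}$; assume $k$ is even whenever $r\equiv 0\pmod m$. Let $P^{k,m}_{D,r}$ denote the classical Jacobi Poincaré series $P^{k,m}_{n,r}$ (degree $g=1$) with $n=\frac{D+r^2}{4m}$, so that $D=4mn-r^2$. Let $B_1>\log 2$ be a fixed constant and $M(x)=\exp\left\{\frac{B_1\log x}{\log\log 2x}\right\}$ for $x\ge 2$. If $D>\frac m\pi$ and \[ M\left(\frac{\pi D}{m}\right)\sigma_0(D)\,D<\frac{m^{8/7}}{\lambda},\] where $\sigma_0(D)=\sum_{d\mid D}1$, $\lambda=(2\sqrt2\,\pi^{5/3}A)^{3/2}$ and $A=\frac1\pi\left(\frac{2}{6^{2/3}}+\frac{54}{2^{5/6}}+\frac{16}{2^{3/4}}\right)$, then $P^{k,m}_{D,r}\not\equiv 0$.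
   Context: Notation: $e(z)=e^{2\pi iz}$, $\mathcal H$ the upper half plane. The Jacobi group $\Gamma^J_1=SL(2,\mathbb{Z})\ltimes\mathbb{Z}^2$ acts on functions $\phi:\mathcal H\times\mathbb{C}\to\mathbb{C}$ by $\phi|_{k,m}\gamma(\tau,z)=(c\tau+d)^{-k}e\big(-c(c\tau+d)^{-1}m(z+\lambda\tau+\mu)^2+m\lambda^2+2\lambda mz\big)\phi\left(\frac{a\tau+b}{c\tau+d},\frac{z+\lambda\tau+\mu}{c\tau+d}\right)$ for $\gamma=(\begin{pmatrix}a&b\\c&d\end{pmatrix},(\lambda,\mu))$. For $n\in\mathbb{N}$, $r\in\mathbb{Z}$ with $4mn>r^2$ and $k>3$, the Poincaré series is $P^{k,m}_{n,r}=\sum_{\gamma\in\Gamma^J_{1,\infty}\backslash\Gamma^J_1}e(n\tau+rz)|_{k,m}\gamma$, where $\Gamma^J_{1,\infty}=\{(\begin{pmatrix}1&t\\0&1\end{pmatrix},(0,\mu)):t,\mu\in\mathbb{Z}\}$; it is a Jacobi cusp form of weight $k$ and index $m$.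
   Formalization: The slash action is taken with $m\lambda^2\tau$ in place of the printed $m\lambda^2$ (with which the series diverges), and $M(x)$, defined only for $x\ge 2$, is extended by the constant $M(2)$ when $\pi D/m<2$. *)

theory Defs
  imports "HOL-Analysis.Analysis" "HOL-Algebra.Coset" "HOL-Number_Theory.Cong"
begin

type_synonym jacobi_elt = "(int ^ 2 ^ 2) \<times> (int ^ 2)"

text \<open>
  The Jacobi group: the integral matrices of determinant 1 act on row vectors from the right,
  with \<open>(A, X) (B, Y) = (A B, X B + Y)\<close>. In \<open>(A, X)\<close>, \<open>X = (\<lambda>, \<mu>)\<close>.
\<close>

definition jacobi_group :: "jacobi_elt monoid" where
  "jacobi_group =
     \<lparr> carrier = {(A, X). det A = 1},
       mult = (\<lambda>(A, X) (B, Y). (A ** B, X v* B + Y)),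
       one = (mat 1, 0) \<rparr>"

definition translation_elt :: "int \<Rightarrow> int \<Rightarrow> jacobi_elt" where
  "translation_elt t \<mu> = (vector [vector [1, t], vector [0, 1]], vector [0, \<mu>])"

definition jacobi_group_inf :: "jacobi_elt set" where
  "jacobi_group_inf = {translation_elt t \<mu> | t \<mu>. True}"

definition upper_half_plane :: "complex set" where
  "upper_half_plane = {\<tau>. Im \<tau> > 0}"

definition ee :: "complex \<Rightarrow> complex" where
  "ee z = exp (2 * complex_of_real pi * \<i> * z)"

text \<open>
  The weight \<open>k\<close>, index \<open>m\<close> action. The factor \<open>\<tau>\<close> in the term \<open>m \<lambda>\<^sup>2 \<tau>\<close> is required for this to be
  a group action (and for the convergence of the Poincare series).
\<close>

definition jacobi_slash ::
  "int \<Rightarrow> int \<Rightarrow> (complex \<Rightarrow> complex \<Rightarrow> complex) \<Rightarrow> jacobi_elt \<Rightarrow> complex \<Rightarrow> complex \<Rightarrow> complex" where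
  "jacobi_slash k m \<phi> = (\<lambda>(A, X) \<tau> z.
     let a = of_int (A $ 1 $ 1); b = of_int (A $ 1 $ 2);
         c = of_int (A $ 2 $ 1); d = of_int (A $ 2 $ 2);
         l = of_int (X $ 1); u = of_int (X $ 2)
     in (c * \<tau> + d) powi (- k)
        * ee (- (c * of_int m * (z + l * \<tau> + u)\<^sup>2 / (c * \<tau> + d))
             + of_int m * l\<^sup>2 * \<tau> + 2 * l * of_int m * z)
        * \<phi> ((a * \<tau> + b) / (c * \<tau> + d)) ((z + l * \<tau> + u) / (c * \<tau> + d)))"

definition jacobi_exp :: "int \<Rightarrow> int \<Rightarrow> complex \<Rightarrow> complex \<Rightarrow> complex" where
  "jacobi_exp n r \<tau> z = ee (of_int n * \<tau> + of_int r * z)"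

text \<open>
  The summand depends only on the coset, see \<open>jacobi_exp_slash_translation\<close> below, so the choice of
  the representative is immaterial.
\<close>

definition jacobi_poincare :: "int \<Rightarrow> int \<Rightarrow> int \<Rightarrow> int \<Rightarrow> complex \<Rightarrow> complex \<Rightarrow> complex" where
  "jacobi_poincare k m n r \<tau> z =
     (\<Sum>\<^sub>\<infinity>C \<in> rcosets\<^bsub>jacobi_group\<^esub> jacobi_group_inf.
        jacobi_slash k m (jacobi_exp n r) (SOME \<gamma>. \<gamma> \<in> C) \<tau> z)"

text \<open>
  Indexing by \<open>D = 4 m n - r\<^sup>2\<close>; the division is exact when \<open>D \<equiv> - r\<^sup>2 (mod 4 m)\<close>.
\<close>

definition jacobi_poincare_disc :: "int \<Rightarrow> int \<Rightarrow> int \<Rightarrow> int \<Rightarrow> complex \<Rightarrow> complex \<Rightarrow> complex" where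
  "jacobi_poincare_disc k m D r = jacobi_poincare k m ((D + r\<^sup>2) div (4 * m)) r"

definition num_divisors :: "int \<Rightarrow> nat" where
  "num_divisors D = card {d. d > 0 \<and> d dvd D}"

text \<open>
  The function \<open>M(x) = exp (B log x / log log 2x)\<close> is given by this formula for \<open>x \<ge> 2\<close> only (the
  denominator is 0 at \<open>x = exp 1 / 2\<close> and negative below it), but it is also evaluated at
  arguments in \<open>(1, 2)\<close>. There it is extended by the constant \<open>M(2)\<close>.
\<close>

definition growth_M :: "real \<Rightarrow> real \<Rightarrow> real" where
  "growth_M B x = (let y = max x 2 in exp (B * ln y / ln (ln (2 * y))))"

definition const_A :: real where
  "const_A = 1 / pi * (2 / 6 powr (2/3) + 54 / 2 powr (5/6) + 16 / 2 powr (3/4))"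

definition const_lambda :: real where
  "const_lambda = (2 * sqrt 2 * pi powr (5/3) * const_A) powr (3/2)"

lemma growth_M_eq: "x \<ge> 2 \<Longrightarrow> growth_M B x = exp (B * ln x / ln (ln (2 * x)))"
  by (simp add: growth_M_def max_def)

lemma group_jacobi_group: "group jacobi_group"
proof (rule groupI)
  fix x assume x: "x \<in> carrier jacobi_group"
  obtain A X where [simp]: "x = (A, X)" by (cases x)
  have dA: "A$1$1 * A$2$2 - A$1$2 * A$2$1 = 1"
    using x by (simp add: jacobi_group_def det_2)
  define B :: "int^2^2" where "B = vector [vector [A$2$2, - A$1$2], vector [- A$2$1, A$1$1]]"
  have "det B = 1" using dA by (simp add: B_def det_2 algebra_simps)
  moreover have "B ** A = mat 1"
    using dA by (simp add: B_def vec_eq_iff forall_2 matrix_matrix_mult_def sum_2 mat_def algebra_simps)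
  moreover have "- (X v* B) v* A = - X"
  proof -
    have "- (X v* B) v* A = - ((X v* B) v* A)"
      by (simp add: vector_matrix_mult_def vec_eq_iff sum_negf)
    then show ?thesis
      using \<open>B ** A = mat 1\<close> by (simp add: vector_matrix_mul_assoc)
  qed
  ultimately show "\<exists>y\<in>carrier jacobi_group. y \<otimes>\<^bsub>jacobi_group\<^esub> x = \<one>\<^bsub>jacobi_group\<^esub>"
    by (intro bexI[of _ "(B, - (X v* B))"]) (auto simp: jacobi_group_def)
qed (auto simp: jacobi_group_def det_mul matrix_mul_assoc vector_matrix_mul_assoc
       vector_matrix_left_distrib add.assoc vector_matrix_mul_rid)

lemma translation_elt_mult:
  "translation_elt s \<mu> \<otimes>\<^bsub>jacobi_group\<^esub> translation_elt t \<nu> = translation_elt (s + t) (\<mu> + \<nu>)"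
  by (simp add: jacobi_group_def translation_elt_def vec_eq_iff forall_2 sum_2
      matrix_matrix_mult_def vector_matrix_mult_def)

lemma subgroup_jacobi_group_inf: "subgroup jacobi_group_inf jacobi_group"
proof -
  interpret group jacobi_group by (rule group_jacobi_group)
  have carr: "translation_elt t \<mu> \<in> carrier jacobi_group" for t \<mu>
    by (simp add: jacobi_group_def translation_elt_def det_2)
  have one: "\<one>\<^bsub>jacobi_group\<^esub> = translation_elt 0 0"
    by (simp add: jacobi_group_def translation_elt_def vec_eq_iff forall_2 mat_def)
  have inv: "inv\<^bsub>jacobi_group\<^esub> (translation_elt t \<mu>) = translation_elt (- t) (- \<mu>)" for t \<mu>
    by (rule inv_equality) (simp_all add: translation_elt_mult one carr)
  show ?thesis
  proof (rule subgroupI)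
    show "jacobi_group_inf \<subseteq> carrier jacobi_group"
      using carr by (force simp: jacobi_group_inf_def)
    show "jacobi_group_inf \<noteq> {}"
      unfolding jacobi_group_inf_def by blast
    show "inv\<^bsub>jacobi_group\<^esub> x \<in> jacobi_group_inf" if "x \<in> jacobi_group_inf" for x
      using that inv unfolding jacobi_group_inf_def by fastforce
    show "x \<otimes>\<^bsub>jacobi_group\<^esub> y \<in> jacobi_group_inf"
      if "x \<in> jacobi_group_inf" "y \<in> jacobi_group_inf" for x y
      using that translation_elt_mult unfolding jacobi_group_inf_def by fastforce
  qed
qed

lemma ee_add_of_int: "ee (z + of_int j) = ee z"
proof -
  have "ee (of_int j) = 1"
    unfolding ee_def by (rule exp_eq_1[THEN iffD2]) (auto intro: exI[of _ j])
  then show ?thesis by (simp add: ee_def ring_distribs exp_add)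
qed

lemma jacobi_exp_slash_translation:
  assumes "\<gamma> \<in> carrier jacobi_group" "\<tau> \<in> upper_half_plane"
  shows "jacobi_slash k m (jacobi_exp n r) (translation_elt t \<nu> \<otimes>\<^bsub>jacobi_group\<^esub> \<gamma>) \<tau> z
       = jacobi_slash k m (jacobi_exp n r) \<gamma> \<tau> z"
proof -
  obtain A X where g: "\<gamma> = (A, X)" by (cases \<gamma>)
  define a b c d :: complex where "a = of_int (A$1$1)" and "b = of_int (A$1$2)"
    and "c = of_int (A$2$1)" and "d = of_int (A$2$2)"
  define l u :: complex where "l = of_int (X$1)" and "u = of_int (X$2)"
  define j w where "j = c * \<tau> + d" and "w = z + l * \<tau> + u"
  define T N M :: complex where "T = of_int t" and "N = of_int \<nu>" and "M = of_int m"
  have dA: "A$1$1 * A$2$2 - A$1$2 * A$2$1 = 1"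
    using assms by (simp add: g jacobi_group_def det_2)
  have j: "j \<noteq> 0"
  proof
    assume "j = 0"
    then have "Im j = 0" "Re j = 0" by simp_all
    then have "A$2$1 = 0" "A$2$2 = 0"
      using assms(2) by (auto simp: j_def c_def d_def upper_half_plane_def)
    then show False using dA by simp
  qed
  define K where "K = j powi (- k)"
  have 1: "jacobi_slash k m (jacobi_exp n r) \<gamma> \<tau> z =
      K * ee (- (c * M * w\<^sup>2 / j) + M * l\<^sup>2 * \<tau> + 2 * l * M * z
             + (of_int n * ((a * \<tau> + b) / j) + of_int r * (w / j)))"
    by (simp add: g jacobi_slash_def jacobi_exp_def Let_def a_def b_def c_def d_def l_def u_def
        j_def w_def K_def M_def ee_def exp_add ring_distribs)
  have 2: "jacobi_slash k m (jacobi_exp n r) (translation_elt t \<nu> \<otimes>\<^bsub>jacobi_group\<^esub> \<gamma>) \<tau> z =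
      K * ee (- (c * M * (z + (l + N * c) * \<tau> + (u + N * d))\<^sup>2 / j) + M * (l + N * c)\<^sup>2 * \<tau> + 2 * (l + N * c) * M * z
             + (of_int n * (((a + T * c) * \<tau> + (b + T * d)) / j)
                + of_int r * ((z + (l + N * c) * \<tau> + (u + N * d)) / j)))"
    by (simp add: g jacobi_group_def translation_elt_def jacobi_slash_def jacobi_exp_def Let_def
        matrix_matrix_mult_def vector_matrix_mult_def sum_2 a_def b_def c_def d_def l_def u_def
        j_def K_def M_def N_def T_def ee_def exp_add[symmetric] ring_distribs add_ac mult_ac)
  have w: "z + (l + N * c) * \<tau> + (u + N * d) = w + N * j"
    by (simp add: w_def j_def algebra_simps)
  have q: "((a + T * c) * \<tau> + (b + T * d)) / j = (a * \<tau> + b) / j + T" "(w + N * j) / j = w / j + N"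
    using j by (simp_all add: j_def[symmetric] field_simps) (simp add: j_def algebra_simps)
  have s: "c * M * (w + N * j)\<^sup>2 / j = c * M * w\<^sup>2 / j + 2 * c * M * w * N + c * M * N\<^sup>2 * j"
    using j by (simp add: field_simps power2_eq_square)
  have "- (c * M * (w + N * j)\<^sup>2 / j) + M * (l + N * c)\<^sup>2 * \<tau> + 2 * (l + N * c) * M * z
             + (of_int n * ((a * \<tau> + b) / j + T) + of_int r * (w / j + N))
     = (- (c * M * w\<^sup>2 / j) + M * l\<^sup>2 * \<tau> + 2 * l * M * z
             + (of_int n * ((a * \<tau> + b) / j) + of_int r * (w / j)))
       + (of_int n * T + of_int r * N - 2 * c * M * N * u - c * M * N\<^sup>2 * d)"
    unfolding s by (simp add: w_def j_def algebra_simps power2_eq_square)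
  also have "\<dots> = (- (c * M * w\<^sup>2 / j) + M * l\<^sup>2 * \<tau> + 2 * l * M * z
             + (of_int n * ((a * \<tau> + b) / j) + of_int r * (w / j)))
       + of_int (n * t + r * \<nu> - 2 * A$2$1 * m * \<nu> * X$2 - A$2$1 * m * \<nu>\<^sup>2 * A$2$2)"
    by (simp add: c_def d_def u_def T_def N_def M_def)
  finally show ?thesis unfolding 1 2 w q by (simp only: ee_add_of_int)
qed

end

theory Submission
  imports Defs "HOL-Probability.Distributions"
begin

text \<open>
  Put \<open>x = \<pi> D / m\<close> and restrict the series to \<open>\<tau> = i v\<close>, \<open>z = p \<tau> + q\<close> with \<open>p = - r / 2m\<close> and
  \<open>v = (k - 1) / x\<close>. A coset is determined by the bottom row \<open>(c, d)\<close> of its matrix and an integer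
  \<open>l\<close>, and with \<open>J = |c \<tau> + d|\<close> its term has, relative to the term of the identity, the absolute value
  \<open>J\<^sup>-\<^sup>k exp ((k - 1) (1 - J\<^sup>-\<^sup>2) / 2) exp (- 2 \<pi> m v J\<^sup>-\<^sup>2 (l + p (d - 1) - c q)\<^sup>2)\<close>.
  The choice of \<open>v\<close> makes the first two factors at most \<open>8 J\<^sup>-\<^sup>4\<close>, uniformly in \<open>k\<close>. For \<open>c \<noteq> 0\<close>,
  averaging over \<open>q \<in> [0, 1)\<close> and summing over \<open>l\<close> turns the last factor into a Gaussian integral, so
  these cosets contribute \<open>O (\<Sum> J\<^sup>-\<^sup>3 / sqrt (m v)) = O (x\<^sup>7\<^sup>/\<^sup>2 m\<^sup>-\<^sup>1\<^sup>/\<^sup>2)\<close>, which is tiny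
  because the hypothesis gives \<open>x \<le> m\<^sup>1\<^sup>/\<^sup>7 / 100\<close>. For \<open>c = 0\<close> all but one coset with \<open>d = 1\<close> and one with
  \<open>d = - 1\<close> are negligible, and these two terms are characters in \<open>q\<close> which are either
  different, and then cannot cancel on average, or equal with the same sign because \<open>k\<close> is even.
\<close>

section \<open>Sums over the integers and a Gaussian average\<close>

text \<open>This is \<open>\<bar>c\<bar>\<close> to the power -3/2. At \<open>c = 0\<close> the
  division by zero gives the value 0, so sums may run over all integers.\<close>

definition pweight :: "int \<Rightarrow> real" where
  "pweight c = 1 / sqrt \<bar>of_int c\<bar> ^ 3"

lemma pweight_nonneg [simp]: "0 \<le> pweight c"
  by (simp add: pweight_def)

lemma pweight_minus [simp]: "pweight (- c) = pweight c"
  by (simp add: pweight_def)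

text \<open>Telescoping. With \<open>x = sqrt (n + 1)\<close> and \<open>y = sqrt (n + 2)\<close>
  the difference \<open>4 / x - 4 / y\<close> equals \<open>4 / (x * y * (x + y))\<close>, because
  \<open>y\<^sup>2 - x\<^sup>2 = 1\<close>, and this is at least \<open>1 / x ^ 3\<close> because
  \<open>y * (x + y) \<le> 4 * x\<^sup>2\<close>.\<close>

lemma suminf_pweight_Suc_le: "(\<Sum>n. ennreal (pweight (int (Suc n)))) \<le> 4"
proof (rule suminf_le_const)
  fix N
  define g where "g n = 4 / sqrt (real (Suc n))" for n
  have step: "pweight (int (Suc n)) \<le> g n - g (Suc n)" for n
  proof -
    define x y where "x = sqrt (real (Suc n))" and "y = sqrt (real (Suc (Suc n)))"
    have x: "x > 0" "x\<^sup>2 = real n + 1" and y: "y > 0" "y\<^sup>2 = real n + 2"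
      by (auto simp: x_def y_def)
    have "2 * (x * y) \<le> x\<^sup>2 + y\<^sup>2" using sum_squares_bound[of x y] by (simp add: mult.assoc)
    moreover have "y\<^sup>2 \<le> 2 * x\<^sup>2" using x y by simp
    ultimately have "y * (x + y) \<le> 4 * x\<^sup>2"
      using x(2) y(2) by (simp add: distrib_left power2_eq_square mult.commute)
    then have "y * (x + y) * x \<le> 4 * x\<^sup>2 * x" using x by (intro mult_right_mono) auto
    then have "1 / x ^ 3 \<le> 4 / (y * (x + y) * x)"
      using x y by (simp add: divide_simps power3_eq_cube power2_eq_square)
    also have "\<dots> = 4 * (y\<^sup>2 - x\<^sup>2) / (y * (x + y) * x)" using x y by simp
    also have "\<dots> = 4 / x - 4 / y"
      using x y by (simp add: divide_simps) (simp add: algebra_simps power2_eq_square)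
    finally show ?thesis by (simp add: pweight_def g_def x_def y_def)
  qed
  have "(\<Sum>n<N. pweight (int (Suc n))) \<le> (\<Sum>n<N. g n - g (Suc n))"
    by (intro sum_mono step)
  also have "\<dots> = g 0 - g N" by (simp add: sum_lessThan_telescope')
  also have "\<dots> \<le> 4" by (simp add: g_def)
  finally have "ennreal (\<Sum>n<N. pweight (int (Suc n))) \<le> ennreal 4" by (rule ennreal_leI)
  then show "(\<Sum>n<N. ennreal (pweight (int (Suc n)))) \<le> 4" by simp
qed simp

text \<open>Positive and negative integers contribute at most 4 each, and the value at 0
  vanishes.\<close>

lemma nn_integral_pweight_le: "(\<integral>\<^sup>+c. ennreal (pweight c) \<partial>count_space UNIV) \<le> 8"
proof -
  have half: "(\<integral>\<^sup>+c. ennreal (pweight c) * indicator (range g) c \<partial>count_space UNIV) \<le> 4"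
    if "inj g" "\<And>n. pweight (g n) = pweight (int (Suc n))" for g :: "nat \<Rightarrow> int"
    using suminf_pweight_Suc_le nn_integral_count_compose_inj[OF \<open>inj g\<close>, of "\<lambda>c. ennreal (pweight c)"]
    by (simp add: that nn_integral_count_space_nat)
  let ?g = "\<lambda>n. int (Suc n)" and ?h = "\<lambda>n. - int (Suc n)"
  have U: "c = 0 \<or> c \<in> range ?g \<or> c \<in> range ?h" for c
  proof (cases c rule: int_cases)
    case (nonneg n) then show ?thesis by (cases n) auto
  qed auto
  have "ennreal (pweight c) \<le> ennreal (pweight c) * indicator (range ?g) c
      + ennreal (pweight c) * indicator (range ?h) c" for c
  proof (cases "c = 0")
    case True then show ?thesis by (simp add: pweight_def)
  next
    case False
    then have "indicator (range ?g) c = (1::ennreal) \<or> indicator (range ?h) c = (1::ennreal)"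
      using U[of c] by (auto simp: indicator_def)
    then show ?thesis by (elim disjE) simp_all
  qed
  then have "(\<integral>\<^sup>+c. ennreal (pweight c) \<partial>count_space UNIV)
      \<le> (\<integral>\<^sup>+c. (ennreal (pweight c) * indicator (range ?g) c
              + ennreal (pweight c) * indicator (range ?h) c) \<partial>count_space UNIV)"
    by (intro nn_integral_mono)
  also have "\<dots> \<le> 4 + 4"
    unfolding nn_integral_add[OF borel_measurable_count_space borel_measurable_count_space]
  proof (intro add_mono half)
    show "pweight (- int (Suc n)) = pweight (int (Suc n))" for n by (rule pweight_minus)
  qed (auto simp: inj_def)
  finally show ?thesis by simp
qed

text \<open>Only the term \<open>d = 0\<close> changes, from 0 to 1. The maximum is there because
  \<open>d\<close> may vanish in a bottom row with \<open>c \<noteq> 0\<close>.\<close>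

lemma nn_integral_pweight_max_le:
  "(\<integral>\<^sup>+d. ennreal (pweight (max 1 \<bar>d\<bar>)) \<partial>count_space UNIV) \<le> 9"
proof -
  have "pweight (max 1 \<bar>d\<bar>) = pweight d + indicator {0} d" for d
    by (cases "d = 0") (auto simp: pweight_def max_def)
  then have "(\<integral>\<^sup>+d. ennreal (pweight (max 1 \<bar>d\<bar>)) \<partial>count_space UNIV)
      = (\<integral>\<^sup>+d. (ennreal (pweight d) + indicator {0} d) \<partial>count_space UNIV)"
    by (simp add: ennreal_indicator)
  also have "\<dots> \<le> 8 + 1"
    using add_right_mono[OF nn_integral_pweight_le, of 1] by (simp add: nn_integral_add)
  finally show ?thesis by simp
qed

text \<open>
  Splits the lattice sum of \<open>J\<^sup>-\<^sup>3\<close> into a product of two sums with exponent \<open>3/2\<close>.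
\<close>

lemma lattice_norm_ge:
  fixes a v :: real and c d :: int
  assumes "0 < a" "a \<le> 1" "a \<le> v" "c \<noteq> 0"
  shows "a * (sqrt \<bar>of_int c\<bar> * sqrt \<bar>of_int (max 1 \<bar>d\<bar>)\<bar>) \<le> sqrt ((of_int c * v)\<^sup>2 + (of_int d)\<^sup>2)"
proof -
  define C E :: real where "C = \<bar>of_int c\<bar>" and "E = \<bar>of_int d\<bar>"
  have C: "C \<ge> 1" and E: "E = 0 \<or> E \<ge> 1"
    using assms by (auto simp: C_def E_def)
  have CE: "(of_int c)\<^sup>2 = C\<^sup>2" "(of_int d)\<^sup>2 = E\<^sup>2" by (simp_all add: C_def E_def)
  have M: "\<bar>of_int (max 1 \<bar>d\<bar>)\<bar> = max 1 E" by (simp add: E_def)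
  have "C * max 1 E \<le> C\<^sup>2 + E\<^sup>2"
  proof (cases "E \<ge> 1")
    case True
    have "2 * (C * E) \<le> C\<^sup>2 + E\<^sup>2" using sum_squares_bound[of C E] by (simp add: mult.assoc)
    moreover have "0 \<le> C * E" using C True by simp
    ultimately show ?thesis using True by (simp add: max_def)
  next
    case False
    then show ?thesis using E C by (simp add: power2_eq_square)
  qed
  then have "a\<^sup>2 * (C * max 1 E) \<le> a\<^sup>2 * C\<^sup>2 + a\<^sup>2 * E\<^sup>2"
    using mult_left_mono[of "C * max 1 E" "C\<^sup>2 + E\<^sup>2" "a\<^sup>2"] by (simp add: distrib_left)
  \<comment> \<open>\<open>a\<close> is a common lower bound of \<open>v\<close> and 1, the two
    scales of the lattice; it will be \<open>1 / x\<close>.\<close>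
  also have "\<dots> \<le> v\<^sup>2 * C\<^sup>2 + 1 * E\<^sup>2"
    using assms by (intro add_mono mult_right_mono) (auto simp: power_mono power_le_one)
  finally have "sqrt (a\<^sup>2 * (C * max 1 E)) \<le> sqrt (v\<^sup>2 * C\<^sup>2 + E\<^sup>2)" by simp
  moreover have "sqrt (a\<^sup>2 * (C * max 1 E)) = a * (sqrt C * sqrt (max 1 E))"
    using assms by (simp only: real_sqrt_mult real_sqrt_abs abs_of_pos)
  moreover have "v\<^sup>2 * C\<^sup>2 = (of_int c * v)\<^sup>2" by (simp add: C_def power_mult_distrib)
  ultimately show ?thesis unfolding M CE(2) by (simp only: C_def)
qed

lemma lattice_norm_pweight:
  fixes a v :: real and c d :: int
  assumes "0 < a" "a \<le> 1" "a \<le> v" "c \<noteq> 0"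
  shows "1 / sqrt ((of_int c * v)\<^sup>2 + (of_int d)\<^sup>2) ^ 3 \<le> 1 / a ^ 3 * (pweight c * pweight (max 1 \<bar>d\<bar>))"
proof -
  let ?y = "a * (sqrt \<bar>of_int c\<bar> * sqrt \<bar>of_int (max 1 \<bar>d\<bar>)\<bar>)"
  have y: "0 < ?y" using assms by (auto simp: max_def)
  then have "1 / sqrt ((of_int c * v)\<^sup>2 + (of_int d)\<^sup>2) ^ 3 \<le> 1 / ?y ^ 3"
    using lattice_norm_ge[OF assms, of d] less_le_trans[OF y lattice_norm_ge[OF assms, of d]]
    by (intro divide_left_mono power_mono mult_pos_pos[OF zero_less_power zero_less_power]) auto
  then show ?thesis by (simp add: pweight_def power_mult_distrib)
qed

text \<open>The majorant from \<open>lattice_norm_pweight\<close> is a function of \<open>c\<close>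
  times a function of \<open>d\<close>, so the double sum factors; 72 is 8 times 9.\<close>

lemma nn_integral_lattice_le:
  fixes a v :: real
  assumes "0 < a" "a \<le> 1" "a \<le> v"
  shows "(\<integral>\<^sup>+c. \<integral>\<^sup>+d. (if c = 0 then 0 else ennreal (1 / sqrt ((of_int c * v)\<^sup>2 + (of_int d)\<^sup>2) ^ 3))
            \<partial>count_space (UNIV :: int set) \<partial>count_space (UNIV :: int set)) \<le> ennreal (72 / a ^ 3)"
proof -
  have "(if c = 0 then 0 else ennreal (1 / sqrt ((of_int c * v)\<^sup>2 + (of_int d)\<^sup>2) ^ 3))
      \<le> ennreal (1 / a ^ 3) * ennreal (pweight c) * ennreal (pweight (max 1 \<bar>d\<bar>))" for c d :: int
    using lattice_norm_pweight[OF assms, of c d] assms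
    by (auto simp: ennreal_mult'[symmetric] mult.assoc intro!: ennreal_leI)
  then have "(\<integral>\<^sup>+c. \<integral>\<^sup>+d. (if c = 0 then 0 else ennreal (1 / sqrt ((of_int c * v)\<^sup>2 + (of_int d)\<^sup>2) ^ 3))
            \<partial>count_space (UNIV :: int set) \<partial>count_space (UNIV :: int set))
     \<le> (\<integral>\<^sup>+c. \<integral>\<^sup>+d. ennreal (1 / a ^ 3) * ennreal (pweight c) * ennreal (pweight (max 1 \<bar>d\<bar>))
            \<partial>count_space (UNIV :: int set) \<partial>count_space (UNIV :: int set))"
    by (intro nn_integral_mono)
  also have "\<dots> = ennreal (1 / a ^ 3) * (\<integral>\<^sup>+c. ennreal (pweight c) \<partial>count_space UNIV)
            * (\<integral>\<^sup>+d. ennreal (pweight (max 1 \<bar>d\<bar>)) \<partial>count_space UNIV)"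
    by (simp add: nn_integral_cmult nn_integral_multc)
  also have "\<dots> \<le> ennreal (1 / a ^ 3) * 8 * 9"
    by (intro mult_mono nn_integral_pweight_le nn_integral_pweight_max_le) auto
  also have "\<dots> = ennreal (1 / a ^ 3 * 8 * 9)"
    using assms by (simp add: ennreal_mult'[symmetric] flip: ennreal_numeral)
  finally show ?thesis by simp
qed

section \<open>Unfolding the average over \<open>q\<close> to an integral over the line\<close>

lemma emeasure_int_half_open_right:
  fixes y :: real
  assumes "n \<ge> 0"
  shows "emeasure (count_space UNIV) {l::int. y \<le> of_int l \<and> of_int l < y + of_int n} = ennreal (of_int n)"
proof -
  have "{l::int. y \<le> of_int l \<and> of_int l < y + of_int n} = {\<lceil>y\<rceil>..<\<lceil>y\<rceil> + n}"
    by (auto simp: ceiling_le_iff less_ceiling_iff) linarith+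
  then show ?thesis using assms by simp (metis ennreal_of_nat_eq_real_of_nat of_nat_nat)
qed

text \<open>Needed for negative \<open>c\<close> in \<open>nn_integral_unfold\<close>, where
  dividing by \<open>c\<close> moves the closed end of \<open>[0, 1)\<close> to the other
  side.\<close>

lemma emeasure_int_half_open_left:
  fixes y :: real
  assumes "n \<ge> 0"
  shows "emeasure (count_space UNIV) {l::int. y - of_int n < of_int l \<and> of_int l \<le> y} = ennreal (of_int n)"
proof -
  have "{l::int. y - of_int n < of_int l \<and> of_int l \<le> y} = {\<lfloor>y\<rfloor> - n<..\<lfloor>y\<rfloor>}"
    by (auto simp: le_floor_iff floor_less_iff) linarith+
  then show ?thesis using assms by simp (metis ennreal_of_nat_eq_real_of_nat of_nat_nat)
qed

text \<open>For fixed \<open>l\<close>, the point \<open>l + s - c * q\<close> runs through a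
  half-open interval of length \<open>\<bar>c\<bar>\<close>, and these intervals together cover
  every real number exactly \<open>\<bar>c\<bar>\<close> times. This multiplicity cancels the
  Jacobian of the substitution, so the result depends on neither \<open>c\<close> nor
  \<open>s\<close>.\<close>

lemma nn_integral_unfold:
  fixes g :: "real \<Rightarrow> ennreal" and c :: int
  assumes [measurable]: "g \<in> borel_measurable borel" and c: "c \<noteq> 0"
  shows "(\<integral>\<^sup>+q. (\<integral>\<^sup>+l. g (of_int l + s - of_int c * q) \<partial>count_space (UNIV::int set)) * indicator {0..<1} q \<partial>lborel)
       = (\<integral>\<^sup>+x. g x \<partial>lborel)"
proof -
  define C :: real where "C = of_int c"
  have C: "C \<noteq> 0" using c by (simp add: C_def)
  \<comment> \<open>Marks the \<open>x\<close> that equal \<open>l + s - C * q\<close> for some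
    \<open>q\<close> in \<open>[0, 1)\<close>.\<close>
  let ?I = "\<lambda>l x. indicator {0..<1} ((of_int l + s - x) / C) :: ennreal"
  have cnt: "(\<integral>\<^sup>+l. ?I l x \<partial>count_space (UNIV::int set)) = ennreal \<bar>C\<bar>" for x
  proof -
    let ?S = "{l::int. (of_int l + s - x) / C \<in> {0..<1}}"
    have "(\<integral>\<^sup>+l. ?I l x \<partial>count_space UNIV) = (\<integral>\<^sup>+l. indicator ?S l \<partial>count_space UNIV)"
      by (intro nn_integral_cong) (auto simp: indicator_def)
    also have "\<dots> = emeasure (count_space UNIV) ?S"
      by (rule nn_integral_indicator) simp
    also have "\<dots> = ennreal \<bar>C\<bar>"
    proof (cases "c > 0")
      case True
      then have "?S = {l. (x - s) \<le> of_int l \<and> of_int l < (x - s) + of_int c}"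
        by (auto simp: C_def divide_simps)
      then show ?thesis using emeasure_int_half_open_right[of c "x - s"] True by (simp add: C_def)
    next
      case False
      then have "?S = {l. (x - s) - of_int (- c) < of_int l \<and> of_int l \<le> (x - s)}"
        using c by (auto simp: C_def divide_simps)
      then show ?thesis using emeasure_int_half_open_left[of "- c" "x - s"] False by (simp add: C_def)
    qed
    finally show ?thesis .
  qed
  have aff: "\<bar>C\<bar> * (\<integral>\<^sup>+q. g (of_int l + s - C * q) * indicator {0..<1} q \<partial>lborel) = (\<integral>\<^sup>+x. g x * ?I l x \<partial>lborel)"
    for l :: int
    using nn_integral_real_affine[of "\<lambda>x. g x * ?I l x" "- C" "of_int l + s"] C by simp
  have "\<bar>C\<bar> * (\<integral>\<^sup>+q. (\<integral>\<^sup>+l. g (of_int l + s - C * q) \<partial>count_space (UNIV::int set)) * indicator {0..<1} q \<partial>lborel)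
     = \<bar>C\<bar> * (\<integral>\<^sup>+q. (\<integral>\<^sup>+l. g (of_int l + s - C * q) * indicator {0..<1} q \<partial>count_space (UNIV::int set)) \<partial>lborel)"
    by (simp add: nn_integral_multc)
  also have "\<dots> = (\<integral>\<^sup>+l. \<bar>C\<bar> * (\<integral>\<^sup>+q. g (of_int l + s - C * q) * indicator {0..<1} q \<partial>lborel) \<partial>count_space (UNIV::int set))"
    by (subst nn_integral_count_space_nn_integral) (simp_all add: nn_integral_cmult)
  also have "\<dots> = (\<integral>\<^sup>+l. \<integral>\<^sup>+x. g x * ?I l x \<partial>lborel \<partial>count_space UNIV)"
    by (simp only: aff)
  also have "\<dots> = (\<integral>\<^sup>+x. \<integral>\<^sup>+l. g x * ?I l x \<partial>count_space UNIV \<partial>lborel)"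
    by (subst nn_integral_count_space_nn_integral) simp_all
  also have "\<dots> = (\<integral>\<^sup>+x. g x * \<bar>C\<bar> \<partial>lborel)"
    by (simp add: nn_integral_cmult cnt)
  also have "\<dots> = \<bar>C\<bar> * (\<integral>\<^sup>+x. g x \<partial>lborel)"
    by (simp add: nn_integral_multc mult.commute)
  finally show ?thesis
    using C by (simp add: C_def ennreal_mult_cancel_left)
qed

text \<open>Follows from the total mass 1 of the normal density with variance
  \<open>1 / (2 * b)\<close>.\<close>

lemma nn_integral_gaussian:
  assumes "b > 0"
  shows "(\<integral>\<^sup>+x. ennreal (exp (- (b * x\<^sup>2))) \<partial>lborel) = ennreal (sqrt (pi / b))"
proof -
  define \<sigma> where "\<sigma> = sqrt (1 / (2 * b))"
  have s: "\<sigma> > 0" "\<sigma>\<^sup>2 = 1 / (2 * b)" using assms by (simp_all add: \<sigma>_def)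
  have "1 = (\<integral>\<^sup>+x. ennreal (normal_density 0 \<sigma> x) \<partial>lborel)"
    using prob_space.emeasure_space_1[OF prob_space_normal_density[OF s(1), of 0]]
    by (simp add: emeasure_density)
  also have "\<dots> = (\<integral>\<^sup>+x. ennreal (1 / sqrt (pi / b)) * ennreal (exp (- (b * x\<^sup>2))) \<partial>lborel)"
    using assms by (simp add: normal_density_def s ennreal_mult'[symmetric] mult.commute)
  also have "\<dots> = ennreal (1 / sqrt (pi / b)) * (\<integral>\<^sup>+x. ennreal (exp (- (b * x\<^sup>2))) \<partial>lborel)"
    by (simp add: nn_integral_cmult)
  finally have *: "ennreal (1 / sqrt (pi / b)) * (\<integral>\<^sup>+x. ennreal (exp (- (b * x\<^sup>2))) \<partial>lborel) = 1" ..
  have "ennreal (sqrt (pi / b)) * (ennreal (1 / sqrt (pi / b)) * (\<integral>\<^sup>+x. ennreal (exp (- (b * x\<^sup>2))) \<partial>lborel))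
      = (\<integral>\<^sup>+x. ennreal (exp (- (b * x\<^sup>2))) \<partial>lborel)"
    using assms by (simp add: mult.assoc[symmetric] ennreal_mult'[symmetric])
  then show ?thesis unfolding * by simp
qed

text \<open>With \<open>n = \<bar>l - round s\<bar> \<ge> 1\<close> one has
  \<open>\<bar>l - s\<bar> \<ge> n / 2\<close>, so \<open>exp (- t) \<le> 1 / t\<close> bounds a
  term by \<open>4 / (\<alpha> * n\<^sup>2)\<close>, and 32 is 4 times 8. Such a crude bound
  suffices because \<alpha> is at least 6 * 10 ^ 14 in the application.\<close>

lemma nn_integral_theta_tail_le:
  fixes s \<alpha> :: real
  assumes "\<alpha> > 0"
  shows "(\<integral>\<^sup>+l. (if l = round s then 0 else ennreal (exp (- (\<alpha> * (of_int l - s)\<^sup>2)))) \<partial>count_space UNIV)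
           \<le> ennreal (32 / \<alpha>)"
proof -
  have "(if l = round s then 0 else ennreal (exp (- (\<alpha> * (of_int l - s)\<^sup>2))))
      \<le> ennreal (4 / \<alpha>) * ennreal (pweight (l - round s))" for l
  proof (cases "l = round s")
    case False
    define n :: real where "n = \<bar>of_int (l - round s)\<bar>"
    have n: "n \<ge> 1" using False by (simp add: n_def)
    have "n \<le> \<bar>of_int l - s\<bar> + 1/2" using of_int_round_abs_le[of s] unfolding n_def of_int_diff by linarith
    then have "n \<le> 2 * \<bar>of_int l - s\<bar>" using n by simp
    then have "n\<^sup>2 \<le> (2 * \<bar>of_int l - s\<bar>)\<^sup>2" using n by (intro power_mono) auto
    then have n2: "n\<^sup>2 / 4 \<le> (of_int l - s)\<^sup>2" by (simp add: power_mult_distrib)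
    have "sqrt n ^ 3 = n * sqrt n" using n by (simp add: power3_eq_cube)
    also have "\<dots> \<le> n * n"
    proof (intro mult_left_mono real_le_lsqrt)
      show "n \<le> n\<^sup>2" using n mult_left_mono[of 1 n n] by (simp add: power2_eq_square)
    qed (use n in auto)
    finally have n3: "sqrt n ^ 3 \<le> n\<^sup>2" by (simp add: power2_eq_square)
    let ?x = "\<alpha> * (of_int l - s)\<^sup>2"
    have x: "\<alpha> * n\<^sup>2 / 4 \<le> ?x" using mult_left_mono[OF n2, of \<alpha>] assms by simp
    have pos: "0 < \<alpha> * n\<^sup>2 / 4" using assms n by simp
    have "exp (- ?x) \<le> 1 / ?x"
      using exp_ge_add_one_self[of ?x] x pos
      unfolding exp_minus inverse_eq_divide by (intro divide_left_mono mult_pos_pos[of "exp ?x" ?x]) linarith+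
    also have "\<dots> \<le> 1 / (\<alpha> * n\<^sup>2 / 4)" using x pos by (intro divide_left_mono mult_pos_pos[of ?x "\<alpha> * n\<^sup>2 / 4"]) linarith+
    also have "\<dots> = 4 / \<alpha> * (1 / n\<^sup>2)" by simp
    also have "\<dots> \<le> 4 / \<alpha> * (1 / sqrt n ^ 3)"
      using n n3 assms by (intro mult_left_mono divide_left_mono mult_pos_pos) auto
    finally have "exp (- ?x) \<le> 4 / \<alpha> * pweight (l - round s)" by (simp add: pweight_def n_def)
    then show ?thesis using False assms by (simp add: ennreal_mult'[symmetric] ennreal_leI)
  qed simp
  then have "(\<integral>\<^sup>+l. (if l = round s then 0 else ennreal (exp (- (\<alpha> * (of_int l - s)\<^sup>2)))) \<partial>count_space UNIV)
     \<le> (\<integral>\<^sup>+l. ennreal (4 / \<alpha>) * ennreal (pweight (l - round s)) \<partial>count_space UNIV)"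
    by (intro nn_integral_mono)
  also have "\<dots> = ennreal (4 / \<alpha>) * (\<integral>\<^sup>+l. ennreal (pweight (l - round s)) \<partial>count_space UNIV)"
    by (simp add: nn_integral_cmult)
  also have "(\<integral>\<^sup>+l. ennreal (pweight (l - round s)) \<partial>count_space UNIV) = (\<integral>\<^sup>+l. ennreal (pweight l) \<partial>count_space UNIV)"
    by (rule nn_integral_bij_count_space) (rule bij_betwI[of _ _ _ "\<lambda>l. l + round s"], auto)
  also have "ennreal (4 / \<alpha>) * \<dots> \<le> ennreal (4 / \<alpha>) * 8"
    by (intro mult_left_mono nn_integral_pweight_le) auto
  also have "\<dots> = ennreal (4 / \<alpha> * 8)"
    using assms by (simp add: ennreal_mult'[symmetric] flip: ennreal_numeral)
  finally show ?thesis by simp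
qed

text \<open>
  \<open>t exp (1 - t) \<le> 1\<close> for \<open>t = 1 / j\<^sup>2\<close>, so the power \<open>N\<close> can be lowered to 3.
\<close>

lemma weight_factor_le:
  fixes j :: real
  assumes "j > 0" "N \<ge> 3"
  shows "(exp ((1 - 1 / j\<^sup>2) / 2) / j) ^ N \<le> 8 / j ^ 3"
proof -
  define b where "b = exp ((1 - 1 / j\<^sup>2) / 2) / j"
  have b0: "b > 0" using assms by (simp add: b_def)
  have "b\<^sup>2 = exp (1 - 1 / j\<^sup>2) / j\<^sup>2"
    by (simp add: b_def power_divide power2_eq_square exp_add[symmetric])
  also have "\<dots> = (1 / j\<^sup>2) / exp (1 / j\<^sup>2 - 1)" by (simp add: exp_diff)
  also have "\<dots> \<le> 1" using exp_ge_add_one_self[of "1 / j\<^sup>2 - 1"]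
    by (subst divide_le_eq_1_pos) auto
  finally have b1: "b \<le> 1" using b0 by (simp add: power2_le_iff_abs_le power_le_one_iff)
  \<comment> \<open>The exponent is below 1/2, hence below \<open>ln 2\<close>. This gives
    \<open>b \<le> 2 / j\<close>, whose cube is the bound.\<close>
  have "exp ((1 - 1 / j\<^sup>2) / 2) \<le> exp (ln 2)"
  proof (intro exp_le_cancel_iff[THEN iffD2])
    have "0 < 1 / j\<^sup>2" using assms by simp
    then show "(1 - 1 / j\<^sup>2) / 2 \<le> ln 2"
      using ln2_ge_two_thirds by argo
  qed
  then have "b \<le> 2 / j" unfolding b_def using assms by (intro divide_right_mono) auto
  then have "b ^ 3 \<le> (2 / j) ^ 3" using b0 by (intro power_mono) auto
  moreover have "b ^ N \<le> b ^ 3" using b0 b1 assms by (intro power_decreasing) auto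
  ultimately show ?thesis by (simp add: b_def power_divide)
qed

section \<open>The cosets of the Jacobi group\<close>

text \<open>The bottom row of \<open>A\<close> followed by the first coordinate of \<open>X\<close>
  times the inverse of \<open>A\<close>. Left multiplication by a translation preserves all
  three.\<close>

definition coset_index :: "jacobi_elt \<Rightarrow> int \<times> int \<times> int" where
  "coset_index = (\<lambda>(A, X). (A$2$1, A$2$2, X$1 * A$2$2 - X$2 * A$2$1))"

lemma coset_index_translation:
  "coset_index (translation_elt t \<mu> \<otimes>\<^bsub>jacobi_group\<^esub> \<gamma>) = coset_index \<gamma>"
  by (cases \<gamma>) (simp add: coset_index_def jacobi_group_def translation_elt_def sum_2
      matrix_matrix_mult_def vector_matrix_mult_def algebra_simps)

text \<open>Shows that the index is a complete invariant of the coset: two matrices of determinant 1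
  with the same bottom row differ by a translation, and equality of the third entry makes
  \<open>X' - X\<close> a multiple of that row.\<close>

lemma coset_index_eqD:
  assumes "\<gamma> \<in> carrier jacobi_group" "\<gamma>' \<in> carrier jacobi_group" "coset_index \<gamma> = coset_index \<gamma>'"
  shows "\<exists>t \<mu>. \<gamma>' = translation_elt t \<mu> \<otimes>\<^bsub>jacobi_group\<^esub> \<gamma>"
proof -
  obtain A X A' X' where g: "\<gamma> = (A, X)" "\<gamma>' = (A', X')" by (cases \<gamma>, cases \<gamma>')
  define a b c d l u where "a = A$1$1" and "b = A$1$2" and "c = A$2$1" and "d = A$2$2"
    and "l = X$1" and "u = X$2"
  define a' b' l' u' where "a' = A'$1$1" and "b' = A'$1$2" and "l' = X'$1" and "u' = X'$2"
  note defs = a_def b_def c_def d_def l_def u_def a'_def b'_def l'_def u'_def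
  have A': "A'$2$1 = c" "A'$2$2 = d" and lu: "l * d - u * c = l' * d - u' * c"
    using assms(3) by (auto simp: g coset_index_def defs)
  have det: "a * d - b * c = 1" "a' * d - b' * c = 1"
    using assms(1,2) A' by (simp_all add: g jacobi_group_def det_2 defs)
  \<comment> \<open>Found by Cramer's rule: \<open>(a' - a, b' - b)\<close> is \<open>t\<close>
    times \<open>(c, d)\<close>, \<open>(l' - l, u' - u)\<close> is \<mu> times
    \<open>(c, d)\<close>, and pairing with \<open>(a, b)\<close> has determinant 1.\<close>
  define t \<mu> where "t = b' * a - a' * b" and "\<mu> = (u' - u) * a - (l' - l) * b"
  have 1: "a + t * c = a'" "b + t * d = b'" "\<mu> * c + l = l'" "\<mu> * d + u = u'"
    using det lu unfolding t_def \<mu>_def by algebra+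
  have "\<gamma>' = translation_elt t \<mu> \<otimes>\<^bsub>jacobi_group\<^esub> \<gamma>"
    using 1 A' by (simp add: g jacobi_group_def translation_elt_def vec_eq_iff forall_2 sum_2
      matrix_matrix_mult_def vector_matrix_mult_def defs)
  then show ?thesis by blast
qed

lemma coset_index_cases:
  assumes "\<gamma> \<in> carrier jacobi_group" "coset_index \<gamma> = (0, d, l)"
  shows "d = 1 \<or> d = - 1"
proof -
  obtain A X where g: "\<gamma> = (A, X)" by (cases \<gamma>)
  have "A$1$1 * A$2$2 - A$1$2 * A$2$1 = 1"
    using assms by (simp add: g jacobi_group_def det_2)
  then have "A$1$1 * d = 1" using assms by (simp add: g coset_index_def)
  then show ?thesis using zmult_eq_1_iff by blast
qed

text \<open>Names the representative chosen in \<open>jacobi_poincare\<close>.\<close>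

definition coset_rep :: "jacobi_elt set \<Rightarrow> jacobi_elt" where
  "coset_rep C = (SOME \<gamma>. \<gamma> \<in> C)"

abbreviation jacobi_cosets :: "jacobi_elt set set" where
  "jacobi_cosets \<equiv> rcosets\<^bsub>jacobi_group\<^esub> jacobi_group_inf"

lemma coset_rep:
  assumes "\<gamma> \<in> carrier jacobi_group"
  obtains t \<mu> where
    "coset_rep (jacobi_group_inf #>\<^bsub>jacobi_group\<^esub> \<gamma>) = translation_elt t \<mu> \<otimes>\<^bsub>jacobi_group\<^esub> \<gamma>"
    "coset_rep (jacobi_group_inf #>\<^bsub>jacobi_group\<^esub> \<gamma>) \<in> carrier jacobi_group"
    "jacobi_group_inf #>\<^bsub>jacobi_group\<^esub> coset_rep (jacobi_group_inf #>\<^bsub>jacobi_group\<^esub> \<gamma>)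
       = jacobi_group_inf #>\<^bsub>jacobi_group\<^esub> \<gamma>"
proof -
  interpret group jacobi_group by (rule group_jacobi_group)
  let ?C = "jacobi_group_inf #>\<^bsub>jacobi_group\<^esub> \<gamma>"
  have sub: "jacobi_group_inf \<subseteq> carrier jacobi_group"
    using subgroup_jacobi_group_inf by (rule subgroup.subset)
  have "\<gamma> \<in> ?C" using assms subgroup_jacobi_group_inf by (rule rcos_self)
  then have C: "coset_rep ?C \<in> ?C" unfolding coset_rep_def by (rule someI)
  then obtain t \<mu> where "coset_rep ?C = translation_elt t \<mu> \<otimes>\<^bsub>jacobi_group\<^esub> \<gamma>"
    by (auto simp: r_coset_def jacobi_group_inf_def)
  moreover have "coset_rep ?C \<in> carrier jacobi_group"
    using C r_coset_subset_G[OF sub assms] by blast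
  moreover have "jacobi_group_inf #>\<^bsub>jacobi_group\<^esub> coset_rep ?C = ?C"
    using repr_independence[OF C assms subgroup_jacobi_group_inf] by simp
  ultimately show ?thesis by (rule that)
qed

lemma coset_index_rep:
  assumes "\<gamma> \<in> carrier jacobi_group"
  shows "coset_index (coset_rep (jacobi_group_inf #>\<^bsub>jacobi_group\<^esub> \<gamma>)) = coset_index \<gamma>"
  using coset_rep[OF assms] by (metis coset_index_translation)

lemma jacobi_slash_rep:
  assumes "\<gamma> \<in> carrier jacobi_group" "\<tau> \<in> upper_half_plane"
  shows "jacobi_slash k m (jacobi_exp n r) (coset_rep (jacobi_group_inf #>\<^bsub>jacobi_group\<^esub> \<gamma>)) \<tau> z
       = jacobi_slash k m (jacobi_exp n r) \<gamma> \<tau> z"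
  using coset_rep[OF assms(1)] by (metis jacobi_exp_slash_translation[OF assms])

lemma coset_rep_carrier: "C \<in> jacobi_cosets \<Longrightarrow> coset_rep C \<in> carrier jacobi_group"
  unfolding RCOSETS_def using coset_rep by blast

lemma coset_rep_coset: "C \<in> jacobi_cosets \<Longrightarrow> jacobi_group_inf #>\<^bsub>jacobi_group\<^esub> coset_rep C = C"
  unfolding RCOSETS_def using coset_rep by blast

text \<open>This allows a nonnegative sum over cosets to be bounded by the sum over all integer
  triples.\<close>

lemma inj_on_coset_index_rep: "inj_on (\<lambda>C. coset_index (coset_rep C)) jacobi_cosets"
proof (rule inj_onI)
  interpret group jacobi_group by (rule group_jacobi_group)
  fix C C' assume C: "C \<in> jacobi_cosets" "C' \<in> jacobi_cosets"
    "coset_index (coset_rep C) = coset_index (coset_rep C')"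
  obtain t \<mu> where "coset_rep C' = translation_elt t \<mu> \<otimes>\<^bsub>jacobi_group\<^esub> coset_rep C"
    using coset_index_eqD C coset_rep_carrier by metis
  then have "coset_rep C' \<in> jacobi_group_inf #>\<^bsub>jacobi_group\<^esub> coset_rep C"
    unfolding r_coset_def jacobi_group_inf_def by blast
  from repr_independence[OF this coset_rep_carrier[OF C(1)] subgroup_jacobi_group_inf]
  show "C = C'" using C coset_rep_coset by simp
qed

section \<open>From vanishing of a series to an inequality for finitely many terms\<close>

lemma nn_integral_count_space_mono_set:
  assumes "A \<subseteq> B"
  shows "(\<integral>\<^sup>+x. f x \<partial>count_space A) \<le> (\<integral>\<^sup>+x. f x \<partial>count_space B)"
proof -
  have "(\<integral>\<^sup>+x. f x \<partial>count_space A) = (\<integral>\<^sup>+x. f x * indicator A x \<partial>count_space B)"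
    using assms by (auto simp: nn_integral_count_space_indicator nn_integral_count_space_indicator[of B]
        indicator_def intro!: nn_integral_cong)
  also have "\<dots> \<le> (\<integral>\<^sup>+x. f x \<partial>count_space B)"
    by (intro nn_integral_mono) (auto simp: indicator_def)
  finally show ?thesis .
qed

text \<open>
  No summability is assumed: if \<open>f\<close> is not summable, \<open>infsum\<close> is 0 and the right hand side is infinite.
\<close>

lemma norm_sum_le_of_infsum_eq_0:
  fixes f :: "'a \<Rightarrow> complex"
  assumes F: "finite F" "F \<subseteq> S" and "infsum f S = 0"
  shows "ennreal (norm (sum f F)) \<le> (\<integral>\<^sup>+x. ennreal (norm (f x)) \<partial>count_space (S - F))"
    (is "_ \<le> ?R")
proof (cases "?R")
  case (real R)
  have fin: "(\<Sum>x\<in>G. norm (f x)) \<le> R" if "finite G" "G \<subseteq> S - F" for G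
  proof -
    have "ennreal (\<Sum>x\<in>G. norm (f x)) = (\<integral>\<^sup>+x. ennreal (norm (f x)) \<partial>count_space G)"
      using that by (simp add: nn_integral_count_space_finite)
    also have "\<dots> \<le> ennreal R"
      using nn_integral_count_space_mono_set[OF that(2)] real by metis
    finally show ?thesis using real by simp
  qed
  have abs: "(\<lambda>x. norm (f x)) summable_on (S - F)"
    by (rule nonneg_bdd_above_summable_on) (auto intro!: bdd_aboveI[of _ R] fin)
  then have sum: "f summable_on (S - F)" by (rule abs_summable_summable)
  have "infsum f (F \<union> (S - F)) = sum f F + infsum f (S - F)"
    using F sum by (subst infsum_Un_disjoint) auto
  then have "sum f F = - infsum f (S - F)"
    using assms by (simp add: Un_absorb1 eq_neg_iff_add_eq_0)
  then have "norm (sum f F) = norm (infsum f (S - F))" by simp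
  also have "\<dots> \<le> infsum (\<lambda>x. norm (f x)) (S - F)" using abs by (rule norm_infsum_bound)
  also have "\<dots> \<le> R" using abs fin by (rule infsum_le_finite_sums)
  finally show ?thesis using real by (simp add: ennreal_leI)
qed simp

section \<open>Absolute value of a slashed exponential at \<open>\<tau> = \<i> * v\<close>\<close>

lemma norm_ee: "norm (ee z) = exp (- (2 * pi * Im z))"
  by (simp add: ee_def norm_exp_eq_Re algebra_simps)

text \<open>
  \<open>(p', q') = (p + l, q + u) \<gamma>\<^sup>-\<^sup>1\<close> are the coordinates of the transformed point: \<open>z' = p' \<tau>' + q'\<close>.
\<close>

lemma jacobi_exponent_identity:
  fixes a b c d l u m n r p q \<tau> z :: complex
  assumes det: "a * d - b * c = 1" and j: "c * \<tau> + d \<noteq> 0" and z: "z = p * \<tau> + q"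
  defines "p' \<equiv> (p + l) * d - (q + u) * c" and "q' \<equiv> (q + u) * a - (p + l) * b"
    and "\<tau>' \<equiv> (a * \<tau> + b) / (c * \<tau> + d)"
  shows "(- (c * m * (z + l * \<tau> + u)\<^sup>2 / (c * \<tau> + d)) + m * l\<^sup>2 * \<tau> + 2 * l * m * z)
           + (n * \<tau>' + r * ((z + l * \<tau> + u) / (c * \<tau> + d)))
       = (m * p'\<^sup>2 + r * p' + n) * \<tau>' - m * p\<^sup>2 * \<tau>
           + (m * p' * q' - m * (p + l) * (q + u) + 2 * l * m * q + r * q')"
proof -
  define w J P Q where "w = z + l * \<tau> + u" and "J = c * \<tau> + d" and "P = p + l" and "Q = q + u"
  have w: "w = P * \<tau> + Q" by (simp add: w_def P_def Q_def z algebra_simps)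
  have J: "J \<noteq> 0" using j by (simp add: J_def)
  have "w = p' * (a * \<tau> + b) + q' * J"
    using det unfolding w p'_def q'_def J_def P_def[symmetric] Q_def[symmetric] by algebra
  then have wj: "w / J = p' * \<tau>' + q'"
    using J unfolding \<tau>'_def J_def[symmetric] by (simp add: add_divide_distrib distrib_left)
  \<comment> \<open>This removes the quotient by \<open>J\<close>: only \<open>w / J\<close>
    remains, and it is known from \<open>wj\<close>.\<close>
  have "c * w = P * J - p'"
    unfolding w p'_def J_def P_def[symmetric] Q_def[symmetric] by algebra
  then have "c * m * w\<^sup>2 / J = m * (P * J - p') * (w / J)"
    by (simp add: power2_eq_square mult_ac)
  also have "\<dots> = m * (P * w - p' * (w / J))"
    using J by (simp add: field_simps)
  finally have "c * m * w\<^sup>2 / J = m * (P * w - p' * (p' * \<tau>' + q'))" by (simp only: wj)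
  then show ?thesis
    unfolding w_def[symmetric] J_def[symmetric] wj unfolding w z P_def Q_def by algebra
qed

lemma Im_complex_of_real_mult: "Im (complex_of_real x * z) = x * Im z"
  by simp

text \<open>For real \<open>p\<close> and \<open>q\<close> only the two terms of
  \<open>jacobi_exponent_identity\<close> containing \<open>\<tau>'\<close> and \<tau> contribute to
  the imaginary part, and \<open>Im \<tau>' = v / J\<^sup>2\<close>. Here \<open>P\<close> is the
  coordinate \<open>p'\<close> of the transformed point.\<close>

lemma norm_jacobi_slash:
  fixes v p q :: real and k m n r :: int
  assumes \<gamma>: "\<gamma> \<in> carrier jacobi_group" and idx: "coset_index \<gamma> = (c, d, lam)"
    and v: "v > 0"
  defines "J \<equiv> sqrt ((of_int c * v)\<^sup>2 + (of_int d)\<^sup>2)"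
    and "P \<equiv> of_int lam + p * of_int d - q * of_int c"
  shows "norm (jacobi_slash k m (jacobi_exp n r) \<gamma> (\<i> * of_real v) (of_real p * (\<i> * of_real v) + of_real q))
       = J powi (- k) * exp (- (2 * pi * ((of_int m * P\<^sup>2 + of_int r * P + of_int n) * (v / J\<^sup>2) - of_int m * p\<^sup>2 * v)))"
    and "J > 0"
proof -
  obtain A X where g: "\<gamma> = (A, X)" by (cases \<gamma>)
  define a b l u where "a = A$1$1" and "b = A$1$2" and "l = X$1" and "u = X$2"
  have c: "A$2$1 = c" and d: "A$2$2 = d" and lam: "lam = l * d - u * c"
    using idx by (auto simp: g coset_index_def l_def u_def)
  have detZ: "a * d - b * c = 1"
    using \<gamma> by (simp add: g jacobi_group_def det_2 a_def b_def c d)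
  then have det: "of_int a * of_int d - of_int b * of_int c = (1::complex)"
    "of_int a * of_int d - of_int b * of_int c = (1::real)"
    by (metis of_int_diff of_int_mult of_int_1)+
  define \<tau> z where "\<tau> = \<i> * complex_of_real v" and "z = of_real p * \<tau> + of_real q"
  define j where "j = of_int c * \<tau> + of_int d"
  have "c \<noteq> 0 \<or> d \<noteq> 0" using detZ by auto
  then have "0 < (of_int c * v)\<^sup>2 + (of_int d)\<^sup>2"
    using v by (auto simp: sum_power2_gt_zero_iff)
  then show J: "J > 0" by (simp add: J_def)
  have nj: "norm j = J"
    by (simp add: j_def \<tau>_def cmod_def J_def power2_eq_square algebra_simps)
  then have j: "j \<noteq> 0" using J by auto
  define q' where "q' = (q + of_int u) * of_int a - (p + of_int l) * of_int b"
  have P: "(p + of_int l) * of_int d - (q + of_int u) * of_int c = P"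
    by (simp add: P_def lam algebra_simps)
  define \<tau>' where "\<tau>' = (of_int a * \<tau> + of_int b) / j"
  have "Im \<tau>' = v * (of_int a * of_int d - of_int b * of_int c) / (norm j)\<^sup>2"
    unfolding \<tau>'_def cmod_power2 by (simp add: Im_divide j_def \<tau>_def algebra_simps)
  then have Im\<tau>': "Im \<tau>' = v / J\<^sup>2" by (simp add: det nj)
  let ?e = "(- (of_int c * of_int m * (z + of_int l * \<tau> + of_int u)\<^sup>2 / j) + of_int m * (of_int l)\<^sup>2 * \<tau> + 2 * of_int l * of_int m * z)
           + (of_int n * \<tau>' + of_int r * ((z + of_int l * \<tau> + of_int u) / j))"
  have "?e = (of_int m * (of_real P)\<^sup>2 + of_int r * of_real P + of_int n) * \<tau>' - of_int m * (of_real p)\<^sup>2 * \<tau>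
           + (of_int m * of_real P * of_real q' - of_int m * (of_real p + of_int l) * (of_real q + of_int u)
              + 2 * of_int l * of_int m * of_real q + of_int r * of_real q')"
    using jacobi_exponent_identity[OF det(1) j[unfolded j_def] z_def, of "of_int m" "of_int l" "of_int u" "of_int n" "of_int r"]
    unfolding j_def \<tau>'_def P[symmetric] q'_def by simp
  \<comment> \<open>All coefficients are real, so the last summand, the only one with
    \<open>q'\<close>, drops out of the imaginary part.\<close>
  also have "\<dots> = of_real (of_int m * P\<^sup>2 + of_int r * P + of_int n) * \<tau>' - of_real (of_int m * p\<^sup>2) * \<tau>
           + of_real (of_int m * P * q' - of_int m * (p + of_int l) * (q + of_int u)
              + 2 * of_int l * of_int m * q + of_int r * q')"
    by simp
  finally have "Im ?e = (of_int m * P\<^sup>2 + of_int r * P + of_int n) * (v / J\<^sup>2) - of_int m * p\<^sup>2 * v"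
    by (simp only: Im_complex_of_real plus_complex.sel minus_complex.sel Im_complex_of_real_mult Im\<tau>')
       (simp add: \<tau>_def)
  moreover have "jacobi_slash k m (jacobi_exp n r) \<gamma> \<tau> z = j powi (- k) * ee ?e"
    unfolding g jacobi_slash_def jacobi_exp_def Let_def prod.case c d
      a_def[symmetric] b_def[symmetric] l_def[symmetric] u_def[symmetric] j_def[symmetric]
      \<tau>'_def[symmetric]
    by (simp add: ee_def exp_add distrib_left mult.assoc)
  ultimately show "norm (jacobi_slash k m (jacobi_exp n r) \<gamma> (\<i> * of_real v) (of_real p * (\<i> * of_real v) + of_real q))
       = J powi (- k) * exp (- (2 * pi * ((of_int m * P\<^sup>2 + of_int r * P + of_int n) * (v / J\<^sup>2) - of_int m * p\<^sup>2 * v)))"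
    unfolding \<tau>_def[symmetric] z_def[symmetric]
    by (simp add: norm_mult norm_ee norm_power_int nj)
qed

section \<open>Numerical bounds and characters\<close>

text \<open>Only the middle term of \<open>const_A\<close>, at least 27, and one factor
  \<open>pi\<close> are kept. Then \<open>pi\<close> cancels, \<open>54 * sqrt 2 \<ge> 64\<close>,
  and 64 to the power 3/2 is 512.\<close>

lemma const_lambda_ge: "const_lambda \<ge> 400"
proof -
  have A: "27 / pi \<le> const_A"
  proof -
    have "2 powr (5/6) \<le> (2::real) powr 1" by (intro powr_mono) auto
    then have "54 / 2 \<le> 54 / (2::real) powr (5/6)" by (intro divide_left_mono) auto
    then have "27 \<le> 2 / 6 powr (2/3) + 54 / 2 powr (5/6) + (16::real) / 2 powr (3/4)"
      by (simp add: add_increasing add_increasing2)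
    then have "1 / pi * 27 \<le> const_A" unfolding const_A_def by (intro mult_left_mono) auto
    then show ?thesis by simp
  qed
  have "pi powr 1 \<le> pi powr (5/3)" using pi_gt3 by (intro powr_mono) auto
  then have "2 * sqrt 2 * pi * (27 / pi) \<le> 2 * sqrt 2 * pi powr (5/3) * const_A"
    using A by (intro mult_mono) auto
  moreover have "1.2 \<le> sqrt 2" by (rule real_le_rsqrt) (simp add: power2_eq_square)
  moreover have "2 * sqrt 2 * pi * (27 / pi) = 54 * sqrt 2" by simp
  ultimately have "64 \<le> 2 * sqrt 2 * pi powr (5/3) * const_A" by linarith
  then have "64 powr (3/2) \<le> const_lambda" unfolding const_lambda_def by (intro powr_mono2) auto
  moreover have "(64::real) powr (3/2) = 512"
  proof -
    have "(64::real) powr (3/2) = (8 powr 2) powr (3/2)" by simp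
    also have "\<dots> = 8 powr 3" by (simp only: powr_powr) simp
    finally show ?thesis by simp
  qed
  ultimately show ?thesis by linarith
qed

text \<open>The cut-off at 2 ensures \<open>2 * y \<ge> 4\<close>, which exceeds
  \<open>exp 1\<close>, so the iterated logarithm is nonnegative.\<close>

lemma growth_M_ge_1:
  assumes "B \<ge> 0" shows "growth_M B x \<ge> 1"
proof -
  define y where "y = max x 2"
  have y: "y \<ge> 2" by (simp add: y_def)
  have "exp 1 \<le> 2 * y" using exp_le y by linarith
  then have "1 \<le> ln (2 * y)" using y by (subst ln_ge_iff) auto
  then have "0 \<le> ln (ln (2 * y))" by simp
  then show ?thesis using assms y by (simp add: growth_M_def y_def[symmetric] Let_def)
qed

lemma num_divisors_ge_1:
  assumes "D > 0" shows "num_divisors D \<ge> 1"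
proof -
  have "{d. d > 0 \<and> d dvd D} \<subseteq> {0..D}" using assms by (auto dest: zdvd_imp_le)
  then have "finite {d. d > 0 \<and> d dvd D}" by (rule finite_subset) simp
  moreover have "1 \<in> {d. d > 0 \<and> d dvd D}" by simp
  ultimately show ?thesis unfolding num_divisors_def by (metis One_nat_def Suc_leI card_gt_0_iff empty_iff)
qed

text \<open>Bounding \<open>growth_M\<close> and the number of divisors below by 1 leaves
  \<open>D / m \<le> m powr (1/7) / 400\<close>. Using \<open>pi < 4\<close> and taking seventh
  powers gives the factor \<open>100 ^ 7 = 10 ^ 14\<close>.\<close>

lemma discriminant_bound:
  fixes m D :: int and B1 :: real
  assumes "m > 0" "D > 0" "B1 \<ge> 0"
    and hyp: "growth_M B1 (pi * real_of_int D / real_of_int m) * real (num_divisors D) * real_of_int D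
           < real_of_int m powr (8/7) / const_lambda"
  shows "(pi * of_int D / of_int m) ^ 7 * 10 ^ 14 \<le> of_int m"
proof -
  define G where "G = growth_M B1 (pi * of_int D / of_int m) * real (num_divisors D)"
  have "1 * 1 \<le> G" unfolding G_def
    using growth_M_ge_1[OF assms(3)] num_divisors_ge_1[OF assms(2)] order_trans[OF zero_le_one growth_M_ge_1[OF assms(3)]]
    by (intro mult_mono) auto
  then have "1 * of_int D \<le> G * of_int D" using assms by (intro mult_right_mono) auto
  then have "of_int D \<le> of_int m powr (8/7) / const_lambda" using hyp by (simp add: G_def)
  also have "\<dots> \<le> of_int m powr (8/7) / 400"
    using const_lambda_ge by (intro divide_left_mono) auto
  also have "real_of_int m powr (8/7) = of_int m * of_int m powr (1/7)"
    using powr_add[of "real_of_int m" 1 "1/7"] assms by simp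
  finally have "real_of_int D / of_int m \<le> of_int m powr (1/7) / 400"
    using assms by (simp add: field_simps)
  then have "pi * (of_int D / of_int m) \<le> 4 * (of_int m powr (1/7) / 400)"
    using assms pi_less_4 by (intro mult_mono) auto
  then have "(pi * of_int D / of_int m) ^ 7 \<le> (of_int m powr (1/7) / 100) ^ 7"
    using assms by (intro power_mono) auto
  also have "\<dots> = (of_int m powr (1/7)) ^ 7 / 10 ^ 14" by (simp add: power_divide)
  also have "(of_int m powr (1/7)) ^ 7 = real_of_int m"
    using assms by (subst powr_power) auto
  finally show ?thesis by (simp add: field_simps)
qed

text \<open>Each summand is at most 1/10: \<alpha> is at least 6 * 10 ^ 14, and the square of
  \<open>x ^ 3 * sqrt (pi / \<alpha>)\<close> is at most \<open>x ^ 7 / m\<close>.\<close>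

lemma error_bound:
  fixes x m :: real and N :: nat
  assumes x: "x > 1" and xm: "x ^ 7 * 10 ^ 14 \<le> m" and N: "N \<ge> 3"
  defines "\<alpha> \<equiv> 2 * pi * m * (N / x)"
  shows "64 / \<alpha> + 576 * x ^ 3 * sqrt (pi / \<alpha>) < 1"
proof -
  have x7: "1 \<le> x ^ 7" "x \<le> x ^ 7" using x by (simp_all add: self_le_power)
  have m: "0 < m" using xm x by (smt (verit) x7 mult_pos_pos zero_less_power)
  have "x * 10 ^ 14 \<le> m" using x7 xm by (smt (verit) mult_right_mono zero_le_power)
  moreover have "m * 3 \<le> m * N" using N m by (intro mult_left_mono) auto
  ultimately have mN: "x * 10 ^ 14 \<le> m * N" "3 * m \<le> m * N" using m by linarith+
  have a: "\<alpha> = 2 * pi * (m * N) / x" by (simp add: \<alpha>_def)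
  have "6 * (x * 10 ^ 14) \<le> (2 * pi) * (m * N)"
    using pi_gt3 mN x by (intro mult_mono[of 6 "2 * pi"]) auto
  then have "6 * 10 ^ 14 \<le> \<alpha>" using x by (simp add: a field_simps)
  then have 1: "64 / \<alpha> \<le> 1 / 10" by (subst divide_le_eq) auto
  have "pi / \<alpha> = x / (2 * (m * N))" using m x N by (simp add: a)
  also have "\<dots> \<le> x / m" using m mN x by (intro divide_left_mono) auto
  finally have "x ^ 6 * (pi / \<alpha>) \<le> x ^ 6 * (x / m)" using x by (intro mult_left_mono) auto
  also have "\<dots> = x ^ 7 / m" by (simp add: eval_nat_numeral)
  also have "\<dots> \<le> 1 / 10 ^ 14" using xm m by (simp add: field_simps)
  finally have "sqrt (x ^ 6 * (pi / \<alpha>)) \<le> sqrt ((1 / 10 ^ 7)\<^sup>2)"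
    by (intro real_sqrt_le_mono) (simp add: power2_eq_square)
  moreover have "sqrt (x ^ 6 * (pi / \<alpha>)) = x ^ 3 * sqrt (pi / \<alpha>)"
  proof -
    have "sqrt (x ^ 6) = x ^ 3" using x by (intro real_sqrt_unique) (auto simp: power_mult[symmetric])
    then show ?thesis by (simp only: real_sqrt_mult)
  qed
  moreover have "sqrt ((1 / 10 ^ 7)\<^sup>2) = 1 / (10 ^ 7 :: real)" by (simp only: real_sqrt_abs) simp
  ultimately have "x ^ 3 * sqrt (pi / \<alpha>) \<le> 1 / 10 ^ 7" by linarith
  then have "576 * (x ^ 3 * sqrt (pi / \<alpha>)) \<le> 1 / 10" by simp
  then show ?thesis using 1 by (simp only: mult.assoc)
qed

section \<open>Characters on the unit interval\<close>

lemma ee_of_int [simp]: "ee (of_int j) = 1"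
  using ee_add_of_int[of 0 j] by (simp add: ee_def)

lemma ee_add: "ee (x + y) = ee x * ee y"
  by (simp add: ee_def exp_add distrib_left)

lemma norm_ee_real [simp]: "norm (ee (of_real x)) = 1"
  by (simp add: norm_ee)

lemma continuous_on_ee [continuous_intros]: "continuous_on S f \<Longrightarrow> continuous_on S (\<lambda>x. ee (f x))"
  unfolding ee_def by (intro continuous_intros)

text \<open>For different frequencies, dividing by the first character and integrating over a period
  isolates \<open>a\<close>, and the integral of the norm dominates the norm of the integral. For
  equal frequencies and \<open>b = a\<close> the integrand is constantly
  \<open>2 * norm a\<close>.\<close>

lemma nn_integral_norm_two_characters_ge:
  fixes a b :: complex and r s :: int
  assumes "s \<noteq> r \<or> b = a"
  shows "ennreal (norm a) \<le> (\<integral>\<^sup>+q. ennreal (norm (a * ee (of_int r * of_real q) + b * ee (of_int s * of_real q)))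
            * indicator {0..<1} q \<partial>lborel)" (is "_ \<le> ?R")
proof (cases "s = r")
  case True
  have "ennreal (norm a) \<le> ennreal (2 * norm a) * emeasure lborel {0..<1::real}"
    by (simp add: ennreal_leI)
  also have "\<dots> = ?R"
    using True assms by (simp add: norm_mult norm_ee nn_integral_cmult ring_distribs[symmetric] flip: mult_2)
  finally show ?thesis .
next
  case False
  define w :: complex where "w = of_int (s - r)"
  have w: "w \<noteq> 0" using False by (simp add: w_def)
  have ew: "ee w = 1" by (simp only: w_def ee_of_int)
  define f where "f q = a + b * ee (w * complex_of_real q)" for q
  have cont: "continuous_on S f" for S unfolding f_def by (intro continuous_intros)
  \<comment> \<open>An antiderivative of \<open>f\<close>; its periodic part has equal values at 0
    and 1, so the increment is \<open>a\<close>.\<close>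
  define F where "F q = a * of_real q + b / (2 * of_real pi * \<i> * w) * ee (w * complex_of_real q)" for q
  have F: "(F has_vector_derivative f q) (at q within S)" for q S
  proof -
    have "((\<lambda>z. a * z + b / (2 * of_real pi * \<i> * w) * ee (w * z)) has_field_derivative f q) (at (of_real q))"
      unfolding f_def ee_def using w
      by (auto intro!: derivative_eq_intros simp: field_simps)
    then show ?thesis unfolding F_def by (rule has_vector_derivative_real_field)
  qed
  have "F 1 - F 0 = a" by (simp add: F_def ew ee_def[of 0])
  then have "a = (LBINT q. indicator {0..1} q *\<^sub>R f q)"
    using integral_FTC_atLeastAtMost[of 0 1 F f, OF _ F cont] by simp
  moreover have "integrable lborel (\<lambda>q. indicator {0..1} q *\<^sub>R f q)"
    using borel_integrable_atLeastAtMost'[OF cont] by (simp add: set_integrable_def)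
  ultimately have "ennreal (norm a) \<le> (\<integral>\<^sup>+q. norm (indicator {0..1} q *\<^sub>R f q) \<partial>lborel)"
    using integral_norm_bound_ennreal by metis
  also have "\<dots> = ?R"
  proof (rule nn_integral_cong_AE)
    have *: "norm (a * ee (of_int r * of_real q) + b * ee (of_int s * of_real q)) = norm (f q)" for q
    proof -
      have "ee (of_int s * complex_of_real q) = ee (w * of_real q) * ee (of_int r * of_real q)"
        by (simp add: w_def ee_add[symmetric] algebra_simps)
      then have "a * ee (of_int r * of_real q) + b * ee (of_int s * of_real q) = f q * ee (of_int r * of_real q)"
        by (simp add: f_def algebra_simps)
      then show ?thesis using norm_ee_real[of "of_int r * q"] by (simp add: norm_mult)
    qed
    \<comment> \<open>The closed and the half-open interval differ by the null set
      \<open>{1}\<close>.\<close>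
    show "AE q in lborel. ennreal (norm (indicator {0..1} q *\<^sub>R f q)) =
        ennreal (norm (a * ee (of_int r * of_real q) + b * ee (of_int s * of_real q))) * indicator {0..<1} q"
      using AE_lborel_singleton[of 1] by eventually_elim (auto simp: * indicator_def)
  qed
  finally show ?thesis .
qed

section \<open>The majorant of the Poincare series\<close>

text \<open>The choice of \<open>p\<close> completes the square:
  \<open>m P\<^sup>2 + r P + n = m R\<^sup>2 + D / (4 m)\<close> with \<open>R = P - p\<close>. The
  choice of \<open>v\<close> makes \<open>2 * pi * v * D / (4 * m)\<close> equal to
  \<open>N / 2\<close>, so the discriminant term combines with the power of \<open>J\<close> into an
  \<open>N\<close>-th power. The outer exponential is the absolute value of the identity term, where
  \<open>J = 1\<close> and \<open>R = 0\<close>.\<close>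

lemma norm_jacobi_slash_relative:
  fixes k m n r D :: int and v q :: real and N :: nat
  assumes m: "m > 0" and k: "k = int N + 1" and n: "4 * m * n = D + r\<^sup>2"
    and \<gamma>: "\<gamma> \<in> carrier jacobi_group" "coset_index \<gamma> = (c, d, lam)"
    and v: "v > 0" "pi * of_int D / of_int m * v = N"
  defines "p \<equiv> - (of_int r / (2 * of_int m))" and "J \<equiv> sqrt ((of_int c * v)\<^sup>2 + (of_int d)\<^sup>2)"
  shows "norm (jacobi_slash k m (jacobi_exp n r) \<gamma> (\<i> * of_real v) (of_real p * (\<i> * of_real v) + of_real q))
       = exp (- (2 * pi * v * (of_int n - of_int m * p\<^sup>2 * 2)))
         * ((exp ((1 - 1 / J\<^sup>2) / 2) / J) ^ N / J
             * exp (- (2 * pi * of_int m * v / J\<^sup>2 * (of_int lam + p * (of_int d - 1) - of_int c * q)\<^sup>2)))"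
    and "J > 0"
proof -
  define M P R e where "M = real_of_int m" and "P = of_int lam + p * of_int d - q * of_int c"
    and "R = of_int lam + p * (of_int d - 1) - of_int c * q" and "e = v / J\<^sup>2"
  have M: "M > 0" using m by (simp add: M_def)
  have r: "of_int r = - 2 * M * p" using M by (simp add: p_def M_def)
  have "4 * M * of_int n = of_int D + (of_int r)\<^sup>2"
    unfolding M_def using arg_cong[OF n, of real_of_int] by simp
  then have n': "of_int n = of_int D / (4 * M) + M * p\<^sup>2"
    using M unfolding r by (simp add: field_simps power2_eq_square)
  have P: "P = R + p" by (simp add: P_def R_def algebra_simps)
  have quad: "M * P\<^sup>2 + of_int r * P + of_int n = M * R\<^sup>2 + of_int D / (4 * M)"
    unfolding n' r P by (simp add: power2_eq_square algebra_simps)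
  have Nv: "real N = 4 * pi * (of_int D / (4 * M)) * v"
    using v M by (simp add: M_def)
  note J = norm_jacobi_slash[OF \<gamma> v(1), folded J_def]
  show "J > 0" by (rule J(2))
  have "norm (jacobi_slash k m (jacobi_exp n r) \<gamma> (\<i> * of_real v) (of_real p * (\<i> * of_real v) + of_real q))
      = J powi (- k) * exp (- (2 * pi * ((M * P\<^sup>2 + of_int r * P + of_int n) * e - M * p\<^sup>2 * v)))"
    using J(1)[where p = p and q = q] unfolding P_def M_def e_def .
  also have "J powi (- k) = 1 / J ^ N / J"
  proof -
    have "k = int (Suc N)" using k by simp
    then show ?thesis by (simp only: power_int_minus power_int_of_nat) (simp add: divide_inverse)
  qed
  also have "- (2 * pi * ((M * P\<^sup>2 + of_int r * P + of_int n) * e - M * p\<^sup>2 * v))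
      = - (2 * pi * v * (of_int n - M * p\<^sup>2 * 2)) + real N * ((1 - 1 / J\<^sup>2) / 2) + - (2 * pi * M * v / J\<^sup>2 * R\<^sup>2)"
    unfolding quad Nv e_def unfolding n' by (simp add: algebra_simps diff_divide_distrib)
  finally show "norm (jacobi_slash k m (jacobi_exp n r) \<gamma> (\<i> * of_real v) (of_real p * (\<i> * of_real v) + of_real q))
       = exp (- (2 * pi * v * (of_int n - of_int m * p\<^sup>2 * 2)))
         * ((exp ((1 - 1 / J\<^sup>2) / 2) / J) ^ N / J
             * exp (- (2 * pi * of_int m * v / J\<^sup>2 * (of_int lam + p * (of_int d - 1) - of_int c * q)\<^sup>2)))"
    unfolding exp_add M_def[symmetric] R_def[symmetric]
    by (simp add: power_divide exp_of_nat_mult[symmetric])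
qed

text \<open>The factor \<open>8 / J ^ 4\<close> is the bound of \<open>weight_factor_le\<close> with
  one more division by \<open>J\<close>. The cosets with \<open>c = 0\<close> are left to
  \<open>majorant_c_zero\<close>.\<close>

definition majorant_c_nonzero :: "real \<Rightarrow> real \<Rightarrow> real \<Rightarrow> real \<Rightarrow> int \<Rightarrow> int \<Rightarrow> int \<Rightarrow> ennreal" where
  "majorant_c_nonzero v \<alpha> p q c d l =
     (if c = 0 then 0
      else ennreal (8 / sqrt ((of_int c * v)\<^sup>2 + (of_int d)\<^sup>2) ^ 4)
           * ennreal (exp (- (\<alpha> / ((of_int c * v)\<^sup>2 + (of_int d)\<^sup>2) * (of_int l + p * (of_int d - 1) - of_int c * q)\<^sup>2))))"

lemma borel_measurable_nn_integral_count_space [measurable (raw)]: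
  fixes f :: "'i::countable \<Rightarrow> 'a \<Rightarrow> ennreal"
  assumes [measurable]: "\<And>i. f i \<in> borel_measurable M"
  shows "(\<lambda>x. \<integral>\<^sup>+i. f i x \<partial>count_space UNIV) \<in> borel_measurable M"
proof (rule sigma_finite_measure.borel_measurable_nn_integral)
  show "sigma_finite_measure (count_space (UNIV :: 'i set))" by (rule sigma_finite_measure_count_space)
  show "(\<lambda>(x, i). f i x) \<in> borel_measurable (M \<Otimes>\<^sub>M count_space UNIV)"
    by measurable
qed

lemma measurable_majorant_c_nonzero [measurable]: "(\<lambda>q. majorant_c_nonzero v \<alpha> p q c d l) \<in> borel_measurable borel"
  by (cases "c = 0") (simp_all add: majorant_c_nonzero_def)

text \<open>For fixed \<open>(c, d)\<close> unfolding yields a Gaussian integral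
  \<open>sqrt (pi / \<alpha>) * J\<close>, which lowers the exponent of \<open>J\<close> from 4 to
  3. The lattice sum of these cubes gives 576 as 8 times 72.\<close>

lemma nn_integral_majorant_c_nonzero_le:
  assumes a: "0 < a" "a \<le> 1" "a \<le> v" and \<alpha>: "\<alpha> > 0"
  shows "(\<integral>\<^sup>+q. (\<integral>\<^sup>+c. \<integral>\<^sup>+d. \<integral>\<^sup>+l. majorant_c_nonzero v \<alpha> p q c d l
            \<partial>count_space UNIV \<partial>count_space UNIV \<partial>count_space UNIV) * indicator {0..<1} q \<partial>lborel)
         \<le> ennreal (576 / a ^ 3 * sqrt (pi / \<alpha>))"
proof -
  let ?J = "\<lambda>c d. sqrt ((of_int c * v)\<^sup>2 + (of_int d)\<^sup>2)"
  have inner: "(\<integral>\<^sup>+q. (\<integral>\<^sup>+l. majorant_c_nonzero v \<alpha> p q c d l \<partial>count_space UNIV) * indicator {0..<1} q \<partial>lborel)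
      = ennreal (8 * sqrt (pi / \<alpha>)) * (if c = 0 then 0 else ennreal (1 / ?J c d ^ 3))" for c d :: int
  proof (cases "c = 0")
    case False
    define J b where "J = ?J c d" and "b = \<alpha> / ((of_int c * v)\<^sup>2 + (of_int d)\<^sup>2)"
    have pos: "0 < (of_int c * v)\<^sup>2 + (of_int d)\<^sup>2" using False a by (simp add: sum_power2_gt_zero_iff)
    have J: "J > 0" "J\<^sup>2 = (of_int c * v)\<^sup>2 + (of_int d)\<^sup>2" using pos by (simp_all add: J_def)
    have b: "b > 0" using pos \<alpha> by (simp add: b_def)
    have "(\<integral>\<^sup>+q. (\<integral>\<^sup>+l. majorant_c_nonzero v \<alpha> p q c d l \<partial>count_space UNIV) * indicator {0..<1} q \<partial>lborel)
       = (\<integral>\<^sup>+q. ennreal (8 / J ^ 4) * ((\<integral>\<^sup>+l. ennreal (exp (- (b * (of_int l + p * (of_int d - 1) - of_int c * q)\<^sup>2)))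
             \<partial>count_space UNIV) * indicator {0..<1} q) \<partial>lborel)"
      using False by (simp add: majorant_c_nonzero_def J_def b_def nn_integral_cmult mult.assoc)
    also have "\<dots> = ennreal (8 / J ^ 4) * (\<integral>\<^sup>+q. ((\<integral>\<^sup>+l. ennreal (exp (- (b * (of_int l + p * (of_int d - 1) - of_int c * q)\<^sup>2)))
             \<partial>count_space UNIV) * indicator {0..<1} q) \<partial>lborel)"
      by (rule nn_integral_cmult) measurable
    also have "\<dots> = ennreal (8 / J ^ 4) * ennreal (sqrt (pi / b))"
      using nn_integral_unfold[of "\<lambda>x. ennreal (exp (- (b * x\<^sup>2)))" c "p * (of_int d - 1)"] False
      by (simp add: nn_integral_gaussian[OF b])
    also have "sqrt (pi / b) = sqrt (pi / \<alpha>) * J"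
      using \<alpha> by (simp add: b_def J_def real_sqrt_mult[symmetric])
    also have "ennreal (8 / J ^ 4) * ennreal (sqrt (pi / \<alpha>) * J) = ennreal (8 * sqrt (pi / \<alpha>)) * ennreal (1 / J ^ 3)"
      using J \<alpha> by (simp add: ennreal_mult'[symmetric] eval_nat_numeral)
    finally show ?thesis using False by (simp add: J_def)
  qed (simp add: majorant_c_nonzero_def)
  have "(\<integral>\<^sup>+q. (\<integral>\<^sup>+c. \<integral>\<^sup>+d. \<integral>\<^sup>+l. majorant_c_nonzero v \<alpha> p q c d l
            \<partial>count_space UNIV \<partial>count_space UNIV \<partial>count_space UNIV) * indicator {0..<1} q \<partial>lborel)
      = (\<integral>\<^sup>+q. (\<integral>\<^sup>+c. \<integral>\<^sup>+d. (\<integral>\<^sup>+l. majorant_c_nonzero v \<alpha> p q c d l \<partial>count_space UNIV) * indicator {0..<1} q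
             \<partial>count_space UNIV \<partial>count_space UNIV) \<partial>lborel)"
    by (simp add: nn_integral_multc)
  also have "\<dots> = (\<integral>\<^sup>+c. \<integral>\<^sup>+q. (\<integral>\<^sup>+d. (\<integral>\<^sup>+l. majorant_c_nonzero v \<alpha> p q c d l \<partial>count_space UNIV) * indicator {0..<1} q
             \<partial>count_space UNIV) \<partial>lborel \<partial>count_space UNIV)"
    by (rule nn_integral_count_space_nn_integral) simp_all
  also have "\<dots> = (\<integral>\<^sup>+c. \<integral>\<^sup>+d. (\<integral>\<^sup>+q. (\<integral>\<^sup>+l. majorant_c_nonzero v \<alpha> p q c d l \<partial>count_space UNIV) * indicator {0..<1} q
             \<partial>lborel) \<partial>count_space UNIV \<partial>count_space UNIV)"
    by (intro nn_integral_cong nn_integral_count_space_nn_integral) simp_all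
  also have "\<dots> = ennreal (8 * sqrt (pi / \<alpha>)) * (\<integral>\<^sup>+c. \<integral>\<^sup>+d. (if c = 0 then 0 else ennreal (1 / ?J c d ^ 3))
             \<partial>count_space (UNIV::int set) \<partial>count_space (UNIV::int set))"
    by (simp only: inner nn_integral_cmult borel_measurable_count_space)
  also have "\<dots> \<le> ennreal (8 * sqrt (pi / \<alpha>)) * ennreal (72 / a ^ 3)"
    by (intro mult_left_mono nn_integral_lattice_le a) auto
  also have "\<dots> = ennreal (576 / a ^ 3 * sqrt (pi / \<alpha>))"
    using a \<alpha> by (simp add: ennreal_mult'[symmetric])
  finally show ?thesis .
qed

text \<open>The integer nearest to the centre \<open>s\<close> is left out because its Gaussian may
  be close to 1.\<close>

definition theta_tail :: "real \<Rightarrow> real \<Rightarrow> int \<Rightarrow> ennreal" where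
  "theta_tail \<alpha> s l = (if l = round s then 0 else ennreal (exp (- (\<alpha> * (of_int l - s)\<^sup>2))))"

text \<open>
  The two cosets that form the main term correspond to the value 0 of \<open>theta_tail\<close>.
\<close>

definition majorant_c_zero :: "real \<Rightarrow> real \<Rightarrow> int \<Rightarrow> int \<Rightarrow> int \<Rightarrow> ennreal" where
  "majorant_c_zero \<alpha> p c d l =
     (theta_tail \<alpha> 0 l * indicator {1} d + theta_tail \<alpha> (2 * p) l * indicator {- 1} d) * indicator {0} c"

lemma nn_integral_majorant_c_zero_le:
  assumes "\<alpha> > 0"
  shows "(\<integral>\<^sup>+c. \<integral>\<^sup>+d. \<integral>\<^sup>+l. majorant_c_zero \<alpha> p c d l \<partial>count_space UNIV \<partial>count_space UNIV \<partial>count_space UNIV)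
     \<le> ennreal (64 / \<alpha>)"
proof -
  have tail: "(\<integral>\<^sup>+l. theta_tail \<alpha> s l \<partial>count_space UNIV) \<le> ennreal (32 / \<alpha>)" for s
    using nn_integral_theta_tail_le[OF assms] by (simp add: theta_tail_def)
  have "(\<integral>\<^sup>+c. \<integral>\<^sup>+d. \<integral>\<^sup>+l. majorant_c_zero \<alpha> p c d l \<partial>count_space UNIV \<partial>count_space UNIV \<partial>count_space UNIV)
      = (\<integral>\<^sup>+l. theta_tail \<alpha> 0 l \<partial>count_space UNIV) + (\<integral>\<^sup>+l. theta_tail \<alpha> (2 * p) l \<partial>count_space UNIV)"
    by (simp add: majorant_c_zero_def nn_integral_add nn_integral_multc)
  also have "\<dots> \<le> ennreal (32 / \<alpha>) + ennreal (32 / \<alpha>)"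
    by (intro add_mono tail)
  also have "\<dots> = ennreal (64 / \<alpha>)" using assms by (simp flip: ennreal_plus)
  finally show ?thesis .
qed

lemma norm_jacobi_slash_le_major:
  fixes k m n r D :: int and v q :: real and N :: nat
  assumes m: "m > 0" and k: "k = int N + 1" "N \<ge> 3" and n: "4 * m * n = D + r\<^sup>2"
    and \<gamma>: "\<gamma> \<in> carrier jacobi_group" "coset_index \<gamma> = (c, d, lam)"
    and v: "v > 0" "pi * of_int D / of_int m * v = N"
  defines "p \<equiv> - (of_int r / (2 * of_int m))" and "\<alpha> \<equiv> 2 * pi * of_int m * v"
  assumes other: "coset_index \<gamma> \<noteq> (0, 1, 0)" "coset_index \<gamma> \<noteq> (0, - 1, round (2 * p))"
  shows "ennreal (norm (jacobi_slash k m (jacobi_exp n r) \<gamma> (\<i> * of_real v) (of_real p * (\<i> * of_real v) + of_real q)))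
      \<le> ennreal (exp (- (2 * pi * v * (of_int n - of_int m * p\<^sup>2 * 2))))
         * (majorant_c_zero \<alpha> p c d lam + majorant_c_nonzero v \<alpha> p q c d lam)"
proof -
  define J R where "J = sqrt ((of_int c * v)\<^sup>2 + (of_int d)\<^sup>2)" and "R = of_int lam + p * (of_int d - 1) - of_int c * q"
  define K where "K = (exp ((1 - 1 / J\<^sup>2) / 2) / J) ^ N / J * exp (- (\<alpha> / J\<^sup>2 * R\<^sup>2))"
  note rel = norm_jacobi_slash_relative[OF m k(1) n \<gamma> v, folded p_def J_def]
  have J2: "J\<^sup>2 = (of_int c * v)\<^sup>2 + (of_int d)\<^sup>2" by (simp add: J_def)
  have "ennreal K \<le> majorant_c_zero \<alpha> p c d lam + majorant_c_nonzero v \<alpha> p q c d lam"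
  proof (cases "c = 0")
    case True
    then have d: "d = 1 \<or> d = - 1" using coset_index_cases[OF \<gamma>(1)] \<gamma>(2) by simp
    then have "J = 1" by (auto simp: J_def True)
    then have K: "K = exp (- (\<alpha> * R\<^sup>2))" by (simp add: K_def)
    from d show ?thesis
    proof
      assume "d = 1"
      then show ?thesis using True \<gamma>(2) other(1)
        by (simp add: K R_def majorant_c_zero_def majorant_c_nonzero_def theta_tail_def)
    next
      \<comment> \<open>Here \<open>R = lam - 2 * p\<close>, so the Gaussian is centred at
        \<open>2 * p\<close>, and \<open>other(2)\<close> excludes the nearest integer.\<close>
      assume "d = - 1"
      then show ?thesis using True \<gamma>(2) other(2)
        by (simp add: K R_def majorant_c_zero_def majorant_c_nonzero_def theta_tail_def mult.commute)
    qed
  next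
    case False
    have "K \<le> 8 / J ^ 3 / J * exp (- (\<alpha> / J\<^sup>2 * R\<^sup>2))"
      unfolding K_def using weight_factor_le[OF rel(2) k(2)] rel(2)
      by (intro mult_right_mono divide_right_mono) auto
    also have "8 / J ^ 3 / J = 8 / J ^ 4" by (simp add: eval_nat_numeral)
    finally have "ennreal K \<le> ennreal (8 / J ^ 4) * ennreal (exp (- (\<alpha> / J\<^sup>2 * R\<^sup>2)))"
      using rel(2) by (simp add: ennreal_mult'[symmetric] ennreal_leI)
    then show ?thesis
      using False unfolding J2 by (simp add: majorant_c_zero_def majorant_c_nonzero_def J_def R_def)
  qed
  moreover have "norm (jacobi_slash k m (jacobi_exp n r) \<gamma> (\<i> * of_real v) (of_real p * (\<i> * of_real v) + of_real q))
      = exp (- (2 * pi * v * (of_int n - of_int m * p\<^sup>2 * 2))) * K"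
    using rel(1)[where q = q] by (simp add: K_def R_def \<alpha>_def)
  ultimately show ?thesis by (simp add: ennreal_mult' mult_left_mono)
qed

section \<open>Non-vanishing\<close>

lemma nn_integral_count_space_triple:
  "(\<integral>\<^sup>+x. g x \<partial>count_space (UNIV :: ('a \<times> 'b \<times> 'c) set))
     = (\<integral>\<^sup>+c. \<integral>\<^sup>+d. \<integral>\<^sup>+l. g (c, d, l) \<partial>count_space UNIV \<partial>count_space UNIV \<partial>count_space UNIV)"
proof -
  have "(\<integral>\<^sup>+x. g x \<partial>count_space UNIV) = (\<integral>\<^sup>+c. \<integral>\<^sup>+y. g (c, y) \<partial>count_space UNIV \<partial>count_space UNIV)"
    by (rule nn_integral_fst_count_space[symmetric])
  also have "\<dots> = (\<integral>\<^sup>+c. \<integral>\<^sup>+d. \<integral>\<^sup>+l. g (c, d, l) \<partial>count_space UNIV \<partial>count_space UNIV \<partial>count_space UNIV)"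
    by (intro nn_integral_cong nn_integral_fst_count_space[symmetric])
  finally show ?thesis .
qed

lemma jacobi_slash_one:
  "jacobi_slash k m \<phi> (mat 1, 0) \<tau> z = \<phi> \<tau> z"
  by (simp add: jacobi_slash_def mat_def ee_def)

lemma jacobi_slash_minus_one:
  "jacobi_slash k m (jacobi_exp n r) (mat (- 1), vector [l, 0]) \<tau> z
     = (- 1) powi (- k) * ee ((of_int m * (of_int l)\<^sup>2 - of_int r * of_int l + of_int n) * \<tau>
         + of_int (2 * l * m - r) * z)"
proof -
  let ?M = "of_int m :: complex" and ?l = "of_int l :: complex"
  have "jacobi_slash k m (jacobi_exp n r) (mat (- 1), vector [l, 0]) \<tau> z
     = (- 1) powi (- k) * (ee (?M * ?l\<^sup>2 * \<tau> + 2 * ?l * ?M * z) * ee (of_int n * \<tau> - of_int r * (z + ?l * \<tau>)))"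
    by (simp add: jacobi_slash_def jacobi_exp_def mat_def Let_def)
  also have "ee (?M * ?l\<^sup>2 * \<tau> + 2 * ?l * ?M * z) * ee (of_int n * \<tau> - of_int r * (z + ?l * \<tau>))
     = ee ((?M * ?l\<^sup>2 - of_int r * ?l + of_int n) * \<tau> + of_int (2 * l * m - r) * z)"
    unfolding ee_add[symmetric] by (rule arg_cong[of _ _ ee]) (simp add: algebra_simps)
  finally show ?thesis .
qed

theorem theorem1p2:
  fixes m k D r :: int and B1 :: real
  assumes "m > 0" and "k > 3" and "D > 0"
    and "[D = - (r\<^sup>2)] (mod (4 * m))"
    and "[r = 0] (mod m) \<Longrightarrow> even k"
    and "B1 > ln 2"
    and "real_of_int D > real_of_int m / pi"
    and "growth_M B1 (pi * real_of_int D / real_of_int m) * real (num_divisors D) * real_of_int D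
           < real_of_int m powr (8/7) / const_lambda"
  shows "\<not> (\<forall>\<tau>\<in>upper_half_plane. \<forall>z. jacobi_poincare_disc k m D r \<tau> z = 0)"
proof
  assume vanish: "\<forall>\<tau>\<in>upper_half_plane. \<forall>z. jacobi_poincare_disc k m D r \<tau> z = 0"
  define n where "n = (D + r\<^sup>2) div (4 * m)"
  have "4 * m dvd D + r\<^sup>2" using assms(4) by (simp add: cong_iff_dvd_diff)
  then have n: "4 * m * n = D + r\<^sup>2" by (simp add: n_def)
  define N where "N = nat (k - 1)"
  have N: "k = int N + 1" "N \<ge> 3" using assms(2) by (auto simp: N_def)
  define x where "x = pi * of_int D / of_int m"
  \<comment> \<open>The lower bound on \<open>D\<close> says exactly this; it gives
    \<open>x \<le> x ^ 7\<close> in \<open>error_bound\<close> and admits \<open>1 / x\<close> as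
    the lattice scale.\<close>
  have x: "x > 1" using assms(1,7) by (simp add: x_def field_simps)
  have "0 < ln (2 :: real)" by simp
  with assms(6) have "B1 \<ge> 0" by linarith
  then have "x ^ 7 * 10 ^ 14 \<le> of_int m"
    using discriminant_bound[OF assms(1,3) _ assms(8)] by (simp add: x_def)
  then have err: "64 / (2 * pi * of_int m * (N / x)) + 576 * x ^ 3 * sqrt (pi / (2 * pi * of_int m * (N / x))) < 1"
    using error_bound[OF x _ N(2)] by blast
  \<comment> \<open>With this height \<open>J\<close> to the power \<open>- N\<close> times
    \<open>exp (N * (1 - 1 / J\<^sup>2) / 2)\<close> is largest at \<open>J = 1\<close>.\<close>
  define v where "v = N / x"
  have v: "v > 0" "pi * of_int D / of_int m * v = N" using x N by (simp_all add: v_def x_def[symmetric])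
  define \<alpha> p :: real where "\<alpha> = 2 * pi * of_int m * v" and "p = - (of_int r / (2 * of_int m))"
  have \<alpha>: "\<alpha> > 0" using assms(1) v by (simp add: \<alpha>_def)
  define \<tau> where "\<tau> = \<i> * complex_of_real v"
  have \<tau>: "\<tau> \<in> upper_half_plane" using v by (simp add: \<tau>_def upper_half_plane_def)
  define E where "E = exp (- (2 * pi * v * (of_int n - of_int m * p\<^sup>2 * 2)))"
  define f where "f q C = jacobi_slash k m (jacobi_exp n r) (coset_rep C) \<tau> (of_real p * \<tau> + of_real q)"
    for q C
  have "infsum (f q) jacobi_cosets = jacobi_poincare_disc k m D r \<tau> (of_real p * \<tau> + of_real q)" for q
    by (simp add: f_def[abs_def] coset_rep_def jacobi_poincare_disc_def jacobi_poincare_def n_def)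
  then have zero: "infsum (f q) jacobi_cosets = 0" for q using vanish \<tau> by simp

  \<comment> \<open>The two main cosets and the majorant of the others\<close>
  define l0 where "l0 = round (2 * p)"
  \<comment> \<open>The sign of \<open>- l0\<close> compensates the entry -1 of the matrix, so that
    \<open>coset_index\<close> has third entry \<open>l0\<close>.\<close>
  define \<gamma>1 \<gamma>2 :: jacobi_elt where "\<gamma>1 = (mat 1, 0)" and "\<gamma>2 = (mat (- 1), vector [- l0, 0])"
  define C1 C2 where "C1 = jacobi_group_inf #>\<^bsub>jacobi_group\<^esub> \<gamma>1" and "C2 = jacobi_group_inf #>\<^bsub>jacobi_group\<^esub> \<gamma>2"
  have \<gamma>: "\<gamma>1 \<in> carrier jacobi_group" "\<gamma>2 \<in> carrier jacobi_group"
    by (simp_all add: \<gamma>1_def \<gamma>2_def jacobi_group_def det_2 mat_def)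
  have idx: "coset_index \<gamma>1 = (0, 1, 0)" "coset_index \<gamma>2 = (0, - 1, l0)"
    by (simp_all add: \<gamma>1_def \<gamma>2_def coset_index_def mat_def)
  have C: "C1 \<in> jacobi_cosets" "C2 \<in> jacobi_cosets"
    using \<gamma> unfolding C1_def C2_def RCOSETS_def by blast+
  have idxC: "coset_index (coset_rep C1) = (0, 1, 0)" "coset_index (coset_rep C2) = (0, - 1, l0)"
    using \<gamma> idx by (simp_all add: C1_def C2_def coset_index_rep)
  then have "C1 \<noteq> C2" by auto
  define T where "T q = (\<lambda>(c, d, l). majorant_c_zero \<alpha> p c d l + majorant_c_nonzero v \<alpha> p q c d l)" for q
  have majorized: "ennreal (norm (f q C)) \<le> ennreal E * T q (coset_index (coset_rep C))"
    if "C \<in> jacobi_cosets - {C1, C2}" for C q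
  proof -
    have "coset_index (coset_rep C) \<noteq> coset_index (coset_rep C1)"
      "coset_index (coset_rep C) \<noteq> coset_index (coset_rep C2)"
      using that C inj_on_coset_index_rep by (auto dest: inj_onD)
    moreover obtain c d lam where "coset_index (coset_rep C) = (c, d, lam)" by (cases "coset_index (coset_rep C)")
    ultimately show ?thesis
      using norm_jacobi_slash_le_major[OF assms(1) N n coset_rep_carrier _ v, of C c d lam q] that
      by (simp add: idxC l0_def p_def[symmetric] \<alpha>_def[symmetric] \<tau>_def[symmetric] E_def[symmetric] f_def T_def)
  qed
  define Z where "Z = (\<integral>\<^sup>+c. \<integral>\<^sup>+d. \<integral>\<^sup>+l. majorant_c_zero \<alpha> p c d l
      \<partial>count_space UNIV \<partial>count_space UNIV \<partial>count_space UNIV)"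
  define U where "U q = (\<integral>\<^sup>+c. \<integral>\<^sup>+d. \<integral>\<^sup>+l. majorant_c_nonzero v \<alpha> p q c d l
      \<partial>count_space UNIV \<partial>count_space UNIV \<partial>count_space UNIV)" for q
  have [measurable]: "U \<in> borel_measurable borel" unfolding U_def by measurable
  \<comment> \<open>Since the series vanishes, the two main terms are minus the sum of all others,
    for every \<open>q\<close>.\<close>
  have bound: "ennreal (norm (f q C1 + f q C2)) \<le> ennreal E * (Z + U q)" for q
  proof -
    let ?I = "\<lambda>C. coset_index (coset_rep C)"
    have "ennreal (norm (f q C1 + f q C2)) = ennreal (norm (sum (f q) {C1, C2}))"
      using \<open>C1 \<noteq> C2\<close> by simp
    also have "\<dots> \<le> (\<integral>\<^sup>+C. ennreal (norm (f q C)) \<partial>count_space (jacobi_cosets - {C1, C2}))"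
      using C zero by (intro norm_sum_le_of_infsum_eq_0) auto
    also have "\<dots> \<le> (\<integral>\<^sup>+C. ennreal E * T q (?I C) \<partial>count_space (jacobi_cosets - {C1, C2}))"
      using majorized by (intro nn_integral_mono) auto
    also have "\<dots> = (\<integral>\<^sup>+i. ennreal E * T q i \<partial>count_space (?I ` (jacobi_cosets - {C1, C2})))"
      by (intro nn_integral_bij_count_space inj_on_imp_bij_betw inj_on_subset[OF inj_on_coset_index_rep]) auto
    also have "\<dots> \<le> (\<integral>\<^sup>+i. ennreal E * T q i \<partial>count_space UNIV)"
      by (rule nn_integral_count_space_mono_set) simp
    also have "\<dots> = ennreal E * (Z + U q)"
      by (simp add: nn_integral_cmult nn_integral_count_space_triple T_def nn_integral_add Z_def U_def)
    finally show ?thesis .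
  qed

  \<comment> \<open>The main terms as characters in \<open>q\<close>\<close>
  define s where "s = 2 * - l0 * m - r"
  define a b where "a = ee ((of_int n + of_int r * of_real p) * \<tau>)"
    and "b = (- 1) powi (- k) * ee ((of_int m * (of_int (- l0))\<^sup>2 - of_int r * of_int (- l0) + of_int n + of_int s * of_real p) * \<tau>)"
  have f1: "f q C1 = a * ee (of_int r * of_real q)" for q
    unfolding f_def C1_def jacobi_slash_rep[OF \<gamma>(1) \<tau>] unfolding \<gamma>1_def jacobi_slash_one
    unfolding jacobi_exp_def a_def ee_add[symmetric] by (rule arg_cong[of _ _ ee]) (simp add: algebra_simps)
  have f2: "f q C2 = b * ee (of_int s * of_real q)" for q
    unfolding f_def C2_def jacobi_slash_rep[OF \<gamma>(2) \<tau>] unfolding \<gamma>2_def jacobi_slash_minus_one b_def mult.assoc ee_add[symmetric]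
    by (rule arg_cong[of _ _ "\<lambda>t. _ * ee t"]) (simp add: s_def algebra_simps)
  have "of_int r = - 2 * of_int m * p" using assms(1) by (simp add: p_def)
  then have na: "norm a = E"
    by (simp add: a_def E_def norm_ee \<tau>_def power2_eq_square algebra_simps)
  \<comment> \<open>Equal frequencies force \<open>r = - l0 * m\<close>, so \<open>m\<close> divides
    \<open>r\<close> and \<open>k\<close> is even. The sign in \<open>b\<close> is then 1 and the
    two quadratic terms in \<open>l0\<close> cancel.\<close>
  have ab: "s \<noteq> r \<or> b = a"
  proof (cases "s = r")
    case True
    then have lr: "r = - l0 * m" by (simp add: s_def)
    then have "even k" using assms(5) by (simp add: cong_0_iff)
    moreover have "complex_of_int m * (of_int (- l0))\<^sup>2 - of_int r * of_int (- l0) = 0"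
      unfolding lr by (simp add: power2_eq_square)
    ultimately show ?thesis unfolding True a_def b_def by (simp add: power_int_minus_one_minus)
  qed simp

  \<comment> \<open>Averaging over a period in \<open>q\<close> bounds the main terms below by
    \<open>E\<close>, while the majorant averages to less than \<open>E\<close>.\<close>
  have "ennreal E \<le> (\<integral>\<^sup>+q. ennreal (norm (f q C1 + f q C2)) * indicator {0..<1} q \<partial>lborel)"
    using nn_integral_norm_two_characters_ge[OF ab] by (simp only: f1 f2 na)
  also have "\<dots> \<le> (\<integral>\<^sup>+q. ennreal E * ((Z + U q) * indicator {0..<1} q) \<partial>lborel)"
    unfolding mult.assoc[symmetric] by (intro nn_integral_mono mult_right_mono bound) auto
  also have "\<dots> = ennreal E * (Z + (\<integral>\<^sup>+q. U q * indicator {0..<1} q \<partial>lborel))"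
    by (simp add: nn_integral_cmult nn_integral_add distrib_right)
  also have "\<dots> \<le> ennreal E * (ennreal (64 / \<alpha>) + ennreal (576 / (1 / x) ^ 3 * sqrt (pi / \<alpha>)))"
  proof (intro mult_left_mono add_mono)
    show "Z \<le> ennreal (64 / \<alpha>)" unfolding Z_def by (rule nn_integral_majorant_c_zero_le[OF \<alpha>])
    show "(\<integral>\<^sup>+q. U q * indicator {0..<1} q \<partial>lborel) \<le> ennreal (576 / (1 / x) ^ 3 * sqrt (pi / \<alpha>))"
      unfolding U_def
    proof (rule nn_integral_majorant_c_nonzero_le)
      \<comment> \<open>Taking \<open>a = 1 / x\<close> is what turns \<open>1 / a ^ 3\<close> into
        the factor \<open>x ^ 3\<close> of \<open>err\<close>.\<close>
      show "1 / x \<le> v" using x N by (simp add: v_def divide_right_mono)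
    qed (use x \<alpha> in auto)
  qed simp
  also have "\<dots> = ennreal (E * (64 / \<alpha> + 576 * x ^ 3 * sqrt (pi / \<alpha>)))"
    using x \<alpha> by (simp add: E_def ennreal_mult' ennreal_plus power_divide)
  finally have "E \<le> E * (64 / \<alpha> + 576 * x ^ 3 * sqrt (pi / \<alpha>))"
    using x \<alpha> by (subst (asm) ennreal_le_iff) (auto simp: E_def)
  moreover have "E * (64 / \<alpha> + 576 * x ^ 3 * sqrt (pi / \<alpha>)) < E * 1"
    using err by (intro mult_strict_left_mono) (auto simp: \<alpha>_def v_def E_def)
  ultimately show False by simp
qed

end
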